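(* Let $f\in L^2(\mathbf{T})$ with $\int_{\mathbf{T}} f(x)\,dx=0$ and Fourier expansion $f(x)\sim\sum_{\ell\in\mathbf{Z}} a_\ell e^{2\pi i \ell x}$, $a_0=0$. Define $g(r)=\sum_{k=1}^\infty |a_{rk}|^2$, $G(r)=\sum_{j\le 2r} g(j)$, and $h(n)=\sum_{d\mid n}\big(d\,g(d)+G(d)\big)$. Then $\sum_{k=1}^\infty c_k f(kx)$ converges for almost every $x$ provided $\sum_{k=1}^\infty c_k^2 h(k)(\log k)^2<\infty$. On the other hand, for any $\delta>0$ there exist a function $f\in L^2(\mathbf{T})$ with $\int_{\mathbf{T}} f(x)\,dx=0$ and Fourier coefficient $a_0=0$, and real coefficients $c_k$, such that, with $h$ computed from the Fourier coefficients of this $f$ by the formulas $g(r)=\sum_{k\ge1}|a_{rk}|^2$, $G(r)=\sum_{j\le 2r}g(j)$, $h(n)=\sum_{d\mid n}(d\,g(d)+G(d))$, one has $\sum_{k=1}^\infty c_k^2 h(k)(\log k)^{-\delta}<\infty$, but $\sum_{k=1}^\infty c_k f(kx)$ does not converge almost everywhere.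
   Context: $\mathbf{T}=\mathbf{R}/\mathbf{Z}\simeq[0,1)$ with Lebesgue measure. The coefficients $c_k$ are real.
   Formalization: The function f is taken to be real-valued: since g uses only the coefficients a_{rk} with k ≥ 1, the convergence claim fails for complex f, e.g. f(x)=e^{-2πix}, c_k=1, where h=0 but the series diverges everywhere. *)

theory Defs
  imports "HOL-Analysis.Analysis"
begin

definition L2_torus :: "(real \<Rightarrow> real) \<Rightarrow> bool" where
  "L2_torus f \<longleftrightarrow> f \<in> borel_measurable lborel \<and> (\<forall>x. f (x + 1) = f x)
     \<and> set_integrable lborel {0..1} (\<lambda>x. (f x)\<^sup>2)"

definition fcoef :: "(real \<Rightarrow> real) \<Rightarrow> int \<Rightarrow> complex" where
  "fcoef f l = (LINT x:{0..1}|lborel.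
      complex_of_real (f x) * exp (- (2 * of_real pi * \<i> * of_int l * of_real x)))"

definition gfun :: "(real \<Rightarrow> real) \<Rightarrow> nat \<Rightarrow> real" where
  "gfun f r = (\<Sum>k. (cmod (fcoef f (int r * int (Suc k))))\<^sup>2)"

definition Gfun :: "(real \<Rightarrow> real) \<Rightarrow> nat \<Rightarrow> real" where
  "Gfun f r = (\<Sum>j\<in>{1..2*r}. gfun f j)"

definition hfun :: "(real \<Rightarrow> real) \<Rightarrow> nat \<Rightarrow> real" where
  "hfun f n = (\<Sum>d\<in>{d. d dvd n}. real d * gfun f d + Gfun f d)"

end

theory Submission
  imports Defs "HOL-Computational_Algebra.Primes"
begin

text \<open>
  Convergence: inside a dyadic block \<open>[2^s, 2^(s+1))\<close> the dilates \<open>f(kx)\<close> are quasi-orthogonal,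
  \<open>\<integral>(\<Sum> c_k f(kx))\<^sup>2 \<le> 4 \<Sum> c_k\<^sup>2 h(k)\<close>. To see this, replace \<open>f\<close> by a Fourier partial sum; then
  \<open>\<Sum> b_i e(\<nu>_i x)\<close> has square norm at most \<open>\<Sum> |b_i|\<^sup>2 #{j. \<nu>_j = \<nu>_i}\<close>, and frequencies
  \<open>l m = l' n\<close> collide only if \<open>n / gcd m n\<close> divides \<open>l\<close>. For fixed \<open>m\<close> the pair
  \<open>(m / gcd m n, n / gcd m n)\<close> determines \<open>n\<close>, and \<open>n \<le> 2 m\<close> in a block, which produces
  \<open>\<Sum> d dvd m. G(d)\<close>. The Rademacher--Menshov argument on block \<open>s\<close> costs a factor \<open>(s+1)\<^sup>2\<close>, and
  the block sums are absolutely summable by Cauchy--Schwarz with the weights \<open>1/(s+1)\<^sup>2\<close>;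
  both losses are covered by \<open>(log k)\<^sup>2\<close>.

  Divergence: for \<open>f(x) = cos (2 \<pi> x)\<close> the value \<open>h(p) = 3/4\<close> is the same for all primes \<open>p\<close>, so one
  takes \<open>c = 1\<close> on a set of primes sparse enough that \<open>\<Sum> (log p) powr (-\<delta>)\<close> converges.
\<close>

section \<open>Almost everywhere convergence from quasi-orthogonality in dyadic blocks\<close>

text \<open>The sum of the squared sums of \<open>y\<close> over all nodes of the binary tree on
  \<open>{a..<a + 2 ^ s}\<close>: the pointwise majorant of the Rademacher--Menshov
  argument.\<close>

fun dyadic_squares :: "(nat \<Rightarrow> real) \<Rightarrow> nat \<Rightarrow> nat \<Rightarrow> real" where
  "dyadic_squares y 0 a = (y a)\<^sup>2"
| "dyadic_squares y (Suc s) a =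
     (\<Sum>k\<in>{a..<a + 2 ^ s}. y k)\<^sup>2 + dyadic_squares y s a + dyadic_squares y s (a + 2 ^ s)"

lemma dyadic_squares_nonneg: "0 \<le> dyadic_squares y s a"
  by (induction s arbitrary: a) auto

text \<open>Cauchy--Schwarz with weights 1 and t; the defect is the explicit square (t x - z)^2 / t.
  With t the constant already reached at one level of the tree, the constant grows by exactly 1 at
  the next level.\<close>

lemma weighted_square_add_le:
  fixes x z t :: real
  assumes "t > 0"
  shows "(x + z)\<^sup>2 \<le> (t + 1) * (x\<^sup>2 + z\<^sup>2 / t)"
proof -
  have "(t + 1) * (x\<^sup>2 + z\<^sup>2 / t) - (x + z)\<^sup>2 = (t * x - z)\<^sup>2 / t"
    using assms by (simp add: field_simps power2_eq_square)
  moreover have "(t * x - z)\<^sup>2 / t \<ge> 0" using assms by simp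
  ultimately show ?thesis by linarith
qed

text \<open>A prefix of a dyadic interval either lies in the left half, or is the whole left half (a
  node of the tree) followed by a prefix of the right half. It is thus made of at most one node per
  level, and Cauchy--Schwarz over s + 1 levels gives the constant.\<close>

lemma square_partial_sum_le_dyadic_squares:
  assumes "j \<le> 2 ^ s"
  shows "(\<Sum>k\<in>{a..<a + j}. y k)\<^sup>2 \<le> real (Suc s) * dyadic_squares y s a"
  using assms
proof (induction s arbitrary: a j)
  case 0
  then have "j = 0 \<or> j = 1" by auto
  then show ?case by auto
next
  case (Suc s)
  have nn: "0 \<le> dyadic_squares y s a" "0 \<le> dyadic_squares y s (a + 2 ^ s)"
    by (rule dyadic_squares_nonneg)+
  show ?case
  proof (cases "j \<le> 2 ^ s")
    case True
    have "(\<Sum>k\<in>{a..<a + j}. y k)\<^sup>2 \<le> real (Suc s) * dyadic_squares y s a"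
      by (rule Suc.IH[OF True])
    also have "\<dots> \<le> real (Suc (Suc s)) * dyadic_squares y (Suc s) a"
      using nn by (intro mult_mono) auto
    finally show ?thesis .
  next
    case False
    define i where "i = j - 2 ^ s"
    have j: "j = 2 ^ s + i" and i: "i \<le> 2 ^ s"
      using False Suc.prems by (auto simp: i_def)
    let ?x = "\<Sum>k\<in>{a..<a + 2 ^ s}. y k" and ?z = "\<Sum>k\<in>{a + 2 ^ s..<a + 2 ^ s + i}. y k"
    have split: "(\<Sum>k\<in>{a..<a + j}. y k) = ?x + ?z"
      by (simp add: j sum.atLeastLessThan_concat flip: add.assoc)
    have "?z\<^sup>2 / real (Suc s) \<le> dyadic_squares y s (a + 2 ^ s)"
      using Suc.IH[OF i, of "a + 2 ^ s"] by (simp add: field_simps)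
    then have "?x\<^sup>2 + ?z\<^sup>2 / real (Suc s) \<le> dyadic_squares y (Suc s) a"
      using nn by simp
    then have "(real (Suc s) + 1) * (?x\<^sup>2 + ?z\<^sup>2 / real (Suc s))
        \<le> real (Suc (Suc s)) * dyadic_squares y (Suc s) a"
      by (intro mult_mono) auto
    with weighted_square_add_le[of "real (Suc s)" ?x ?z] show ?thesis
      unfolding split by linarith
  qed
qed

lemma borel_measurable_dyadic_squares [measurable]:
  assumes [measurable]: "\<And>k. X k \<in> borel_measurable M"
  shows "(\<lambda>x. dyadic_squares (\<lambda>k. X k x) s a) \<in> borel_measurable M"
  by (induction s arbitrary: a) auto

text \<open>The nodes of one level partition the interval, so by the assumed bound each of the s + 1
  levels contributes at most the total weight.\<close>

lemma nn_integral_dyadic_squares_le: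
  fixes X :: "nat \<Rightarrow> 'a \<Rightarrow> real"
  assumes [measurable]: "\<And>k. X k \<in> borel_measurable M"
    and w: "\<And>k. 0 \<le> w k"
    and le: "\<And>i j. a \<le> i \<Longrightarrow> i \<le> j \<Longrightarrow> j \<le> a + 2 ^ s \<Longrightarrow>
      (\<integral>\<^sup>+x. ennreal ((\<Sum>k\<in>{i..<j}. X k x)\<^sup>2) \<partial>M) \<le> ennreal (\<Sum>k\<in>{i..<j}. w k)"
  shows "(\<integral>\<^sup>+x. ennreal (dyadic_squares (\<lambda>k. X k x) s a) \<partial>M)
    \<le> ennreal (real (Suc s) * (\<Sum>k\<in>{a..<a + 2 ^ s}. w k))"
  using le
proof (induction s arbitrary: a)
  case 0
  from 0[of a "Suc a"] show ?case by simp
next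
  case (Suc s)
  let ?W = "\<lambda>i j. \<Sum>k\<in>{i..<j}. w k"
  have W: "0 \<le> ?W i j" for i j using w by (intro sum_nonneg) auto
  let ?b = "a + 2 ^ s"
  have split: "?W a (a + 2 ^ Suc s) = ?W a ?b + ?W ?b (?b + 2 ^ s)"
    by (subst sum.atLeastLessThan_concat) (auto simp: mult_2 add.assoc)
  have "(\<integral>\<^sup>+x. ennreal (dyadic_squares (\<lambda>k. X k x) (Suc s) a) \<partial>M)
    = (\<integral>\<^sup>+x. ennreal ((\<Sum>k\<in>{a..<?b}. X k x)\<^sup>2) \<partial>M)
      + (\<integral>\<^sup>+x. ennreal (dyadic_squares (\<lambda>k. X k x) s a) \<partial>M)
      + (\<integral>\<^sup>+x. ennreal (dyadic_squares (\<lambda>k. X k x) s ?b) \<partial>M)"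
    by (subst nn_integral_add[symmetric], simp, simp)+
       (auto simp: ennreal_plus dyadic_squares_nonneg add_nonneg_nonneg intro!: nn_integral_cong)
  also have "\<dots> \<le> ennreal (?W a ?b) + ennreal (real (Suc s) * ?W a ?b)
      + ennreal (real (Suc s) * ?W ?b (?b + 2 ^ s))"
    by (intro add_mono Suc.IH Suc.prems) auto
  also have "\<dots> = ennreal (?W a ?b + real (Suc s) * ?W a ?b + real (Suc s) * ?W ?b (?b + 2 ^ s))"
    using W by (simp add: ennreal_plus)
  also have "\<dots> \<le> ennreal (real (Suc (Suc s)) * ?W a (a + 2 ^ Suc s))"
    using W[of a ?b] W[of ?b "?b + 2 ^ s"]
    unfolding split by (intro ennreal_leI) (auto simp: algebra_simps)
  finally show ?case .
qed

text \<open>Assumption \<open>B\<close> makes the partial sums up to powers of 2 converge;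
  assumption \<open>Q\<close> makes the oscillation inside each block tend to zero.\<close>

lemma summable_from_dyadic_blocks:
  fixes y :: "nat \<Rightarrow> real"
  assumes Q: "summable (\<lambda>s. real (Suc s) * dyadic_squares y s (2 ^ s))"
    and B: "summable (\<lambda>s. (real (Suc s))\<^sup>2 * (\<Sum>k\<in>{2 ^ s..<2 ^ Suc s}. y k)\<^sup>2)"
  shows "summable y"
proof -
  define b where "b s = (\<Sum>k\<in>{2 ^ s..<2 ^ Suc s}. y k)" for s
  have inv: "summable (\<lambda>s. 1 / (real (Suc s))\<^sup>2)"
    using inverse_power_summable[of 2, where 'a = real]
    by (subst summable_Suc_iff) (simp add: field_simps)
  have "summable b"
  proof (rule summable_comparison_test)
    show "summable (\<lambda>s. (real (Suc s))\<^sup>2 * (b s)\<^sup>2 + 1 / (real (Suc s))\<^sup>2)"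
      using B inv unfolding b_def by (rule summable_add)
    \<comment> \<open>Inequality of arithmetic and geometric means for t |b| and 1/t with t = s + 1:
      the weight \<open>(real (Suc s))\<^sup>2\<close> in \<open>B\<close> is what makes the second
      summand a convergent series.\<close>
    have "\<bar>b s\<bar> \<le> (real (Suc s))\<^sup>2 * (b s)\<^sup>2 + 1 / (real (Suc s))\<^sup>2" for s
    proof -
      define t where "t = real (Suc s)"
      have t: "t > 0" by (simp add: t_def)
      have "0 \<le> (t * \<bar>b s\<bar> - 1 / t)\<^sup>2" by simp
      also have "\<dots> = t\<^sup>2 * (b s)\<^sup>2 + 1 / t\<^sup>2 - 2 * \<bar>b s\<bar>"
        using t by (simp add: power2_diff power_mult_distrib power_divide)
      finally show ?thesis unfolding t_def by linarith
    qed
    then show "\<exists>N. \<forall>n\<ge>N. norm (b n) \<le> (real (Suc n))\<^sup>2 * (b n)\<^sup>2 + 1 / (real (Suc n))\<^sup>2"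
      by auto
  qed
  define L where "L = y 0 + suminf b"
  have P: "(\<Sum>k<2 ^ s. y k) = y 0 + (\<Sum>t<s. b t)" for s
  proof (induction s)
    case (Suc s)
    have "(\<Sum>k<2 ^ Suc s. y k) = (\<Sum>k<2 ^ s. y k) + b s"
      unfolding b_def lessThan_atLeast0 by (subst sum.atLeastLessThan_concat) auto
    with Suc show ?case by simp
  qed simp
  have lim: "(\<lambda>s. \<Sum>k<2 ^ s. y k) \<longlonglongrightarrow> L"
    unfolding P L_def using \<open>summable b\<close>
    by (intro tendsto_add tendsto_const) (rule summable_LIMSEQ)
  have "(\<lambda>n. \<Sum>k<n. y k) \<longlonglongrightarrow> L"
  proof (rule LIMSEQ_I)
    fix e :: real assume "e > 0"
    obtain s1 where s1: "\<And>s. s \<ge> s1 \<Longrightarrow> norm ((\<Sum>k<2 ^ s. y k) - L) < e / 2"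
      using LIMSEQ_D[OF lim, of "e/2"] \<open>e > 0\<close> by auto
    obtain s2 where s2: "\<And>s. s \<ge> s2 \<Longrightarrow> norm (real (Suc s) * dyadic_squares y s (2 ^ s) - 0) < (e / 2)\<^sup>2"
      using LIMSEQ_D[OF summable_LIMSEQ_zero[OF Q], of "(e/2)\<^sup>2"] \<open>e > 0\<close> by auto
    have "norm ((\<Sum>k<n. y k) - L) < e" if n: "n \<ge> 2 ^ (s1 + s2)" for n
    proof -
      have "n \<ge> 1" using n by (meson le_trans one_le_numeral one_le_power)
      then obtain s where s: "2 ^ s \<le> n" "n < 2 ^ (s + 1)"
        using ex_power_ivl1[of 2 n] by auto
      have "(2::nat) ^ (s1 + s2) < 2 ^ (s + 1)" using n s(2) by linarith
      then have "s1 + s2 < s + 1" by (rule power_less_imp_less_exp[rotated]) simp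
      then have ss: "s \<ge> s1" "s \<ge> s2" by auto
      \<comment> \<open>The sum up to n is split at the largest power of 2 below it. The first part
        is within e/2 of \<open>L\<close>; the rest is a prefix of block s, bounded through the tree
        majorant by e/2.\<close>
      define j where "j = n - 2 ^ s"
      have j: "n = 2 ^ s + j" "j \<le> 2 ^ s" using s by (auto simp: j_def)
      let ?r = "\<Sum>k\<in>{2 ^ s..<2 ^ s + j}. y k"
      have "(\<Sum>k<n. y k) = (\<Sum>k<2 ^ s. y k) + ?r"
        unfolding j(1) lessThan_atLeast0 by (subst sum.atLeastLessThan_concat) auto
      moreover have "?r\<^sup>2 < (e / 2)\<^sup>2"
        using square_partial_sum_le_dyadic_squares[OF j(2), where a = "2 ^ s" and y = y] s2[OF ss(2)]
        by (simp add: dyadic_squares_nonneg)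
      then have "\<bar>?r\<bar> < e / 2"
        using \<open>e > 0\<close> by (metis abs_le_square_iff abs_of_pos half_gt_zero linorder_not_less)
      ultimately show ?thesis using s1[OF ss(1)] by (simp only: real_norm_def)
    qed
    then show "\<exists>no. \<forall>n\<ge>no. norm (sum y {..<n} - L) < e" by blast
  qed
  then show ?thesis by (auto simp: summable_def sums_def)
qed

section \<open>Almost everywhere summability from integral bounds\<close>

lemma summable_regroup_dyadic:
  fixes v :: "nat \<Rightarrow> real"
  assumes "summable v" and nn: "\<And>k. 0 \<le> v k"
  shows "summable (\<lambda>s. \<Sum>k\<in>{2 ^ s..<2 ^ Suc s}. v k)"
proof (rule summableI_nonneg_bounded)
  show "0 \<le> (\<Sum>k\<in>{2 ^ s..<2 ^ Suc s}. v k)" for s using nn by (intro sum_nonneg) auto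
  have eq: "(\<Sum>t<s. \<Sum>k\<in>{2 ^ t..<2 ^ Suc t}. v k) = (\<Sum>k\<in>{1..<2 ^ s}. v k)" for s
  proof (induction s)
    case (Suc s)
    have "(\<Sum>k\<in>{1..<2 ^ s}. v k) + (\<Sum>k\<in>{2 ^ s..<2 ^ Suc s}. v k) = (\<Sum>k\<in>{1..<2 ^ Suc s}. v k)"
      by (rule sum.atLeastLessThan_concat) auto
    with Suc show ?case by simp
  qed simp
  show "(\<Sum>t<s. \<Sum>k\<in>{2 ^ t..<2 ^ Suc t}. v k) \<le> suminf v" for s
    unfolding eq using assms by (intro sum_le_suminf) auto
qed

text \<open>By monotone convergence the sum of the series has finite integral, hence is finite
  almost everywhere.\<close>

lemma AE_summable_if_nn_integral_bound:
  fixes u :: "nat \<Rightarrow> 'a \<Rightarrow> real"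
  assumes [measurable]: "\<And>s. u s \<in> borel_measurable M"
    and nn: "\<And>s x. 0 \<le> u s x" "\<And>s. 0 \<le> W s"
    and le: "\<And>s. (\<integral>\<^sup>+x. ennreal (u s x) \<partial>M) \<le> ennreal (W s)"
    and W: "summable W"
  shows "AE x in M. summable (\<lambda>s. u s x)"
proof -
  have "(\<integral>\<^sup>+x. (\<Sum>s. ennreal (u s x)) \<partial>M) = (\<Sum>s. \<integral>\<^sup>+x. ennreal (u s x) \<partial>M)"
    by (rule nn_integral_suminf) auto
  also have "\<dots> \<le> (\<Sum>s. ennreal (W s))"
    by (rule suminf_le[OF le]) auto
  also have "\<dots> = ennreal (suminf W)"
    using nn W by (intro suminf_ennreal2) auto
  finally have "(\<integral>\<^sup>+x. (\<Sum>s. ennreal (u s x)) \<partial>M) \<noteq> \<infinity>" by (auto simp: top_unique)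
  then have "AE x in M. (\<Sum>s. ennreal (u s x)) \<noteq> \<infinity>"
    by (intro nn_integral_PInf_AE) auto
  then show ?thesis
  proof eventually_elim
    case (elim x)
    then show ?case using nn by (intro summable_suminf_not_top) auto
  qed
qed

text \<open>Both series required by \<open>summable_from_dyadic_blocks\<close> have terms of
  integral at most (s + 1)^2 times the weight of block s, and these bounds are summable because (s +
  1)^2 is dominated by the squared logarithm on the block.\<close>

lemma AE_summable_quasi_orthogonal:
  fixes X :: "nat \<Rightarrow> 'a \<Rightarrow> real"
  assumes [measurable]: "\<And>k. X k \<in> borel_measurable M"
    and w: "\<And>k. 0 \<le> w k"
    and le: "\<And>s i j. 2 ^ s \<le> i \<Longrightarrow> i \<le> j \<Longrightarrow> j \<le> 2 ^ Suc s \<Longrightarrow>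
      (\<integral>\<^sup>+x. ennreal ((\<Sum>k\<in>{i..<j}. X k x)\<^sup>2) \<partial>M) \<le> ennreal (\<Sum>k\<in>{i..<j}. w k)"
    and sm: "summable (\<lambda>k. w k * (ln (real k))\<^sup>2)"
  shows "AE x in M. summable (\<lambda>k. X k x)"
proof -
  let ?W = "\<lambda>s. \<Sum>k\<in>{2 ^ s..<2 ^ Suc s}. w k"
  have W: "0 \<le> ?W s" for s using w by (intro sum_nonneg) auto
  have "summable (\<lambda>s. (real (Suc s))\<^sup>2 * ?W s)"
  proof (rule summable_comparison_test)
    \<comment> \<open>On block s the logarithm is at least s ln 2 \<ge> 2 s / 3, so s + 1 \<le> 2 s
      \<le> 3 ln k once s \<ge> 1; squaring gives 9. Block 0 consists of k = 1, where the logarithm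
      vanishes, so the comparison starts at s = 1.\<close>
    show "summable (\<lambda>s. 9 * (\<Sum>k\<in>{2 ^ s..<2 ^ Suc s}. w k * (ln (real k))\<^sup>2))"
      using w by (intro summable_mult summable_regroup_dyadic sm) auto
    have "(real (Suc s))\<^sup>2 * ?W s \<le> 9 * (\<Sum>k\<in>{2 ^ s..<2 ^ Suc s}. w k * (ln (real k))\<^sup>2)"
      if s: "s \<ge> 1" for s
    proof -
      have "(real (Suc s))\<^sup>2 * w k \<le> 9 * (w k * (ln (real k))\<^sup>2)" if k: "k \<in> {2 ^ s..<2 ^ Suc s}" for k
      proof -
        have "(2::real) ^ s \<le> real k" using k by (simp flip: of_nat_le_iff)
        then have "ln ((2::real) ^ s) \<le> ln (real k)" by (subst ln_le_cancel_iff) (auto intro: less_le_trans[rotated])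
        then have "real s * ln 2 \<le> ln (real k)" by (simp add: ln_realpow)
        moreover have "real s * (2 / 3) \<le> real s * ln 2"
          using ln2_ge_two_thirds by (intro mult_left_mono) auto
        moreover have "1 \<le> real s" using s by simp
        ultimately have "real (Suc s) \<le> 3 * ln (real k)" unfolding of_nat_Suc by linarith
        then have "(real (Suc s))\<^sup>2 \<le> (3 * ln (real k))\<^sup>2" by (intro power_mono) auto
        then have "(real (Suc s))\<^sup>2 * w k \<le> (3 * ln (real k))\<^sup>2 * w k"
          using w by (intro mult_right_mono)
        then show ?thesis by (simp add: power_mult_distrib mult_ac)
      qed
      then show ?thesis unfolding sum_distrib_left by (intro sum_mono) auto
    qed
    then show "\<exists>N. \<forall>s\<ge>N. norm ((real (Suc s))\<^sup>2 * ?W s)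
        \<le> 9 * (\<Sum>k\<in>{2 ^ s..<2 ^ Suc s}. w k * (ln (real k))\<^sup>2)"
      using W by (intro exI[of _ 1]) (auto simp: abs_mult)
  qed
  note W_summable = this
  have "AE x in M. summable (\<lambda>s. real (Suc s) * dyadic_squares (\<lambda>k. X k x) s (2 ^ s))"
  proof (rule AE_summable_if_nn_integral_bound[OF _ _ _ _ W_summable])
    show "(\<integral>\<^sup>+x. ennreal (real (Suc s) * dyadic_squares (\<lambda>k. X k x) s (2 ^ s)) \<partial>M)
        \<le> ennreal ((real (Suc s))\<^sup>2 * ?W s)" for s
    proof -
      have "(\<integral>\<^sup>+x. ennreal (real (Suc s) * dyadic_squares (\<lambda>k. X k x) s (2 ^ s)) \<partial>M)
        = ennreal (real (Suc s)) * (\<integral>\<^sup>+x. ennreal (dyadic_squares (\<lambda>k. X k x) s (2 ^ s)) \<partial>M)"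
        by (subst nn_integral_cmult[symmetric]) (auto simp: ennreal_mult dyadic_squares_nonneg simp del: of_nat_Suc)
      \<comment> \<open>One factor s + 1 is the pointwise Cauchy--Schwarz loss, the other counts the
        levels of the tree.\<close>
      also have "\<dots> \<le> ennreal (real (Suc s)) * ennreal (real (Suc s) * (\<Sum>k\<in>{2 ^ s..<2 ^ s + 2 ^ s}. w k))"
        using w by (intro mult_left_mono nn_integral_dyadic_squares_le le) auto
      also have "\<dots> = ennreal ((real (Suc s))\<^sup>2 * ?W s)"
        using W[of s]
        by (subst ennreal_mult[symmetric]) (auto simp: power2_eq_square mult_2 mult.assoc simp del: of_nat_Suc)
      finally show ?thesis .
    qed
  qed (use W in \<open>auto simp: dyadic_squares_nonneg\<close>)
  moreover have "AE x in M. summable (\<lambda>s. (real (Suc s))\<^sup>2 * (\<Sum>k\<in>{2 ^ s..<2 ^ Suc s}. X k x)\<^sup>2)"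
  proof (rule AE_summable_if_nn_integral_bound[OF _ _ _ _ W_summable])
    show "(\<integral>\<^sup>+x. ennreal ((real (Suc s))\<^sup>2 * (\<Sum>k\<in>{2 ^ s..<2 ^ Suc s}. X k x)\<^sup>2) \<partial>M)
        \<le> ennreal ((real (Suc s))\<^sup>2 * ?W s)" for s
    proof -
      have "(\<integral>\<^sup>+x. ennreal ((real (Suc s))\<^sup>2 * (\<Sum>k\<in>{2 ^ s..<2 ^ Suc s}. X k x)\<^sup>2) \<partial>M)
        = ennreal ((real (Suc s))\<^sup>2) * (\<integral>\<^sup>+x. ennreal ((\<Sum>k\<in>{2 ^ s..<2 ^ Suc s}. X k x)\<^sup>2) \<partial>M)"
        by (subst nn_integral_cmult[symmetric]) (auto simp: ennreal_mult simp del: of_nat_Suc)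
      also have "\<dots> \<le> ennreal ((real (Suc s))\<^sup>2) * ennreal (?W s)"
        by (intro mult_left_mono le[of s]) auto
      also have "\<dots> = ennreal ((real (Suc s))\<^sup>2 * ?W s)"
        using W by (intro ennreal_mult[symmetric]) auto
      finally show ?thesis .
    qed
  qed (use W in auto)
  ultimately show ?thesis
    by eventually_elim (rule summable_from_dyadic_blocks)
qed

section \<open>Characters on the unit interval\<close>

abbreviation unit_interval :: "real measure" where
  "unit_interval \<equiv> restrict_space lborel {0..1}"

lemma emeasure_unit_interval [simp]: "emeasure unit_interval (space unit_interval) = 1"
  by (simp add: emeasure_restrict_space space_restrict_space)

lemma finite_measure_unit_interval: "finite_measure unit_interval"
  by (rule finite_measureI) (simp add: space_restrict_space emeasure_restrict_space)

lemma measurable_unit_intervalI [measurable (raw)]: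
  "f \<in> borel_measurable borel \<Longrightarrow> f \<in> borel_measurable unit_interval"
  by (rule measurable_restrict_space1) simp

definition fchar :: "int \<Rightarrow> real \<Rightarrow> complex" where
  "fchar l x = exp (2 * of_real pi * \<i> * of_int l * of_real x)"

lemma fchar_0 [simp]: "fchar 0 x = 1"
  by (simp add: fchar_def)

lemma fchar_add: "fchar (k + l) x = fchar k x * fchar l x"
  by (simp add: fchar_def exp_add[symmetric] algebra_simps)

lemma fchar_scale: "fchar l (of_int n * x) = fchar (n * l) x"
  by (simp add: fchar_def algebra_simps)

lemma cnj_fchar: "cnj (fchar l x) = fchar (- l) x"
  by (simp add: fchar_def exp_cnj)

lemma norm_fchar [simp]: "norm (fchar l x) = 1"
proof -
  have "2 * of_real pi * \<i> * of_int l * of_real x = \<i> * of_real (2 * pi * of_int l * x)"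
    by simp
  then show ?thesis unfolding fchar_def by (simp only: norm_exp_i_times)
qed

lemma fchar_of_int: "fchar l (of_int n) = 1"
proof -
  have "2 * of_real pi * \<i> * of_int l * of_real (of_int n) = (2 * of_int (l * n) * pi) * \<i>"
    by simp
  then show ?thesis unfolding fchar_def by (metis exp_integer_2pi Ints_of_int of_int_mult)
qed

lemma borel_measurable_fchar [measurable]: "fchar l \<in> borel_measurable borel"
  unfolding fchar_def by (intro borel_measurable_continuous_onI continuous_intros)

lemma integrable_unit_interval_bounded:
  fixes p :: "real \<Rightarrow> 'b :: {banach, second_countable_topology}"
  assumes "p \<in> borel_measurable borel" "\<And>x. norm (p x) \<le> B"
  shows "integrable unit_interval p"
  using assms by (intro finite_measure.integrable_const_bound[OF finite_measure_unit_interval]) auto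

text \<open>For l \<noteq> 0 the primitive exp (c x) / c takes the same value at 0 and at 1.\<close>

lemma integral_fchar: "(LINT x|unit_interval. fchar l x) = (if l = 0 then 1 else 0)"
proof (cases "l = 0")
  case True
  then show ?thesis by (simp add: measure_restrict_space measure_def emeasure_restrict_space space_restrict_space)
next
  case False
  define c where "c = 2 * of_real pi * \<i> * of_int l"
  have c: "c \<noteq> 0" using False by (simp add: c_def)
  have "(LINT x|lborel. indicator {0..1} x *\<^sub>R fchar l x) = exp (c * of_real 1) / c - exp (c * of_real 0) / c"
  proof (rule integral_FTC_atLeastAtMost)
    show "((\<lambda>x. exp (c * of_real x) / c) has_vector_derivative fchar l x) (at x within {0..1})"
      if "0 \<le> x" "x \<le> 1" for x
    proof -
      have "((\<lambda>z. exp (c * z) / c) has_field_derivative exp (c * of_real x)) (at (of_real x))"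
        using c by (auto intro!: derivative_eq_intros)
      from has_vector_derivative_real_field[OF this]
      show ?thesis by (simp add: fchar_def c_def)
    qed
    show "continuous_on {0..1} (fchar l)"
      unfolding fchar_def by (intro continuous_intros)
  qed simp
  moreover have "exp (c * of_real 1) = 1"
    using fchar_of_int[of l 1] by (simp add: fchar_def c_def)
  ultimately show ?thesis using False by (simp add: integral_restrict_space)
qed

section \<open>Density of trigonometric polynomials\<close>

text \<open>Generated inductively so that closure under products and powers is a plain induction; a
  finite set of frequencies with coefficients is recovered in
  \<open>trig_poly_normal_form\<close>.\<close>

inductive trig_poly :: "(real \<Rightarrow> complex) \<Rightarrow> bool" where
  fchar: "trig_poly (\<lambda>x. b * fchar l x)"
| add: "trig_poly p \<Longrightarrow> trig_poly q \<Longrightarrow> trig_poly (\<lambda>x. p x + q x)"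

lemma trig_poly_const: "trig_poly (\<lambda>x. b)"
  using trig_poly.fchar[of b 0] by simp

lemma trig_poly_mult:
  assumes "trig_poly p" "trig_poly q"
  shows "trig_poly (\<lambda>x. p x * q x)"
  using assms(1)
proof induction
  case (fchar b l)
  show ?case using assms(2)
  proof induction
    case (fchar c k)
    have "(\<lambda>x. b * fchar l x * (c * fchar k x)) = (\<lambda>x. (b * c) * fchar (l + k) x)"
      by (simp add: fchar_add mult_ac)
    then show ?case by (simp only: trig_poly.fchar)
  next
    case (add p q)
    then show ?case by (simp add: distrib_left trig_poly.add)
  qed
next
  case (add p q)
  then show ?case by (simp add: distrib_right trig_poly.add)
qed

lemma trig_poly_power: "trig_poly p \<Longrightarrow> trig_poly (\<lambda>x. p x ^ n)"
  by (induction n) (auto intro: trig_poly_const trig_poly_mult)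

lemma trig_poly_sum:
  "finite A \<Longrightarrow> (\<And>k. k \<in> A \<Longrightarrow> trig_poly (p k)) \<Longrightarrow> trig_poly (\<lambda>x. \<Sum>k\<in>A. p k x)"
  by (induction A rule: finite_induct) (auto intro: trig_poly_const trig_poly.add)

lemma trig_poly_cos: "trig_poly (\<lambda>x. of_real (cos (2 * pi * (x - a))))"
proof -
  \<comment> \<open>Euler's formula; the shift by a is absorbed into the coefficients as values of
    characters at a.\<close>
  have "complex_of_real (cos (2 * pi * (x - a)))
      = (fchar (- 1) a / 2) * fchar 1 x + (fchar 1 a / 2) * fchar (- 1) x" for x
    unfolding cos_of_real[symmetric] cos_exp_eq fchar_def
    by (simp add: exp_add[symmetric] algebra_simps add_divide_distrib)
  then show ?thesis by (simp only: trig_poly.add trig_poly.fchar)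
qed

lemma trig_poly_normal_form:
  "trig_poly p \<Longrightarrow> \<exists>A b. finite A \<and> p = (\<lambda>x. \<Sum>l\<in>A. b l * fchar l x)"
proof (induction rule: trig_poly.induct)
  case (fchar b l)
  show ?case by (rule exI[of _ "{l}"], rule exI[of _ "\<lambda>_. b"]) simp
next
  case (add p q)
  then obtain A b A' b' where fin: "finite A" "finite A'"
    and p: "p = (\<lambda>x. \<Sum>l\<in>A. b l * fchar l x)" and q: "q = (\<lambda>x. \<Sum>l\<in>A'. b' l * fchar l x)"
    by blast
  \<comment> \<open>Extending both coefficient families by zero to the union of the frequency sets
    allows termwise addition.\<close>
  have ext: "(\<Sum>l\<in>A. b l * fchar l x) = (\<Sum>l\<in>A \<union> A'. (if l \<in> A then b l else 0) * fchar l x)"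
    "(\<Sum>l\<in>A'. b' l * fchar l x) = (\<Sum>l\<in>A \<union> A'. (if l \<in> A' then b' l else 0) * fchar l x)" for x
    using fin by (auto intro!: sum.mono_neutral_cong_left)
  show ?case
    using fin unfolding p q ext
    by (intro exI[of _ "A \<union> A'"]
        exI[of _ "\<lambda>l. (if l \<in> A then b l else 0) + (if l \<in> A' then b' l else 0)"])
       (simp add: distrib_right sum.distrib)
qed

lemma borel_measurable_trig_poly: "trig_poly p \<Longrightarrow> p \<in> borel_measurable borel"
  by (induction rule: trig_poly.induct) auto

text \<open>Measurable members of the mean-square closure of the trigonometric polynomials on the
  unit interval. The nonnegative integral avoids integrability side conditions on the error.\<close>

definition trig_approximable :: "(real \<Rightarrow> real) \<Rightarrow> bool" where
  "trig_approximable u \<longleftrightarrow> u \<in> borel_measurable borel \<and>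
     (\<forall>\<epsilon>>0. \<exists>p. trig_poly p \<and>
        (\<integral>\<^sup>+x. ennreal ((cmod (of_real (u x) - p x))\<^sup>2) \<partial>unit_interval) < ennreal \<epsilon>)"

section \<open>Closure properties of \<open>trig_approximable\<close>\<close>

lemma norm_add_square_le:
  fixes a b :: "'a :: real_normed_vector"
  shows "(norm (a + b))\<^sup>2 \<le> 2 * (norm a)\<^sup>2 + 2 * (norm b)\<^sup>2"
proof -
  have "(norm (a + b))\<^sup>2 \<le> (norm a + norm b)\<^sup>2"
    by (intro power_mono norm_triangle_ineq norm_ge_zero)
  also have "\<dots> \<le> 2 * (norm a)\<^sup>2 + 2 * (norm b)\<^sup>2"
    using sum_squares_bound[of "norm a" "norm b"] by (simp add: power2_sum)
  finally show ?thesis .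
qed

text \<open>The triangle inequality for squared distances: the factor 2 from
  \<open>norm_add_square_le\<close> on each of the two errors explains the quarter of
  \<epsilon>.\<close>

lemma nn_integral_norm_add_square_less:
  fixes a b :: "'c \<Rightarrow> 'a :: {real_normed_vector, second_countable_topology}"
  assumes [measurable]: "a \<in> borel_measurable M" "b \<in> borel_measurable M"
    and less: "(\<integral>\<^sup>+x. ennreal ((norm (a x))\<^sup>2) \<partial>M) < ennreal (\<epsilon> / 4)"
      "(\<integral>\<^sup>+x. ennreal ((norm (b x))\<^sup>2) \<partial>M) < ennreal (\<epsilon> / 4)"
    and "0 < \<epsilon>"
  shows "(\<integral>\<^sup>+x. ennreal ((norm (a x + b x))\<^sup>2) \<partial>M) < ennreal \<epsilon>"
proof -
  let ?A = "\<integral>\<^sup>+x. ennreal ((norm (a x))\<^sup>2) \<partial>M" and ?B = "\<integral>\<^sup>+x. ennreal ((norm (b x))\<^sup>2) \<partial>M"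
  have "(\<integral>\<^sup>+x. ennreal ((norm (a x + b x))\<^sup>2) \<partial>M)
      \<le> (\<integral>\<^sup>+x. 2 * ennreal ((norm (a x))\<^sup>2) + 2 * ennreal ((norm (b x))\<^sup>2) \<partial>M)"
    using norm_add_square_le
    by (intro nn_integral_mono) (simp flip: ennreal_plus ennreal_numeral ennreal_mult')
  also have "\<dots> = 2 * ?A + 2 * ?B"
    by (simp add: nn_integral_add nn_integral_cmult)
  also have "\<dots> < 2 * ennreal (\<epsilon> / 4) + 2 * ennreal (\<epsilon> / 4)"
    using less by (intro add_strict_mono ennreal_mult_strict_left_mono) auto
  also have "\<dots> = ennreal \<epsilon>"
    using \<open>0 < \<epsilon>\<close> by (simp flip: ennreal_plus ennreal_numeral ennreal_mult')
  finally show ?thesis .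
qed

text \<open>A closure is closed: the distance from u to a trigonometric polynomial is estimated
  through an intermediate v.\<close>

lemma trig_approximable_limit:
  assumes [measurable]: "u \<in> borel_measurable borel"
    and ex: "\<And>\<epsilon>. \<epsilon> > 0 \<Longrightarrow> \<exists>v. trig_approximable v \<and>
      (\<integral>\<^sup>+x. ennreal ((u x - v x)\<^sup>2) \<partial>unit_interval) < ennreal \<epsilon>"
  shows "trig_approximable u"
  unfolding trig_approximable_def
proof (intro conjI allI impI)
  fix \<epsilon> :: real assume "\<epsilon> > 0"
  then obtain v where v: "trig_approximable v"
    and uv: "(\<integral>\<^sup>+x. ennreal ((u x - v x)\<^sup>2) \<partial>unit_interval) < ennreal (\<epsilon> / 4)"
    using ex[of "\<epsilon> / 4"] by auto
  have [measurable]: "v \<in> borel_measurable borel" using v by (simp add: trig_approximable_def)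
  obtain p where p: "trig_poly p"
    and vp: "(\<integral>\<^sup>+x. ennreal ((cmod (of_real (v x) - p x))\<^sup>2) \<partial>unit_interval) < ennreal (\<epsilon> / 4)"
    using v \<open>\<epsilon> > 0\<close> unfolding trig_approximable_def by (meson divide_pos_pos zero_less_numeral)
  note [measurable] = borel_measurable_trig_poly[OF p]
  have uv': "(\<integral>\<^sup>+x. ennreal ((cmod (of_real (u x) - of_real (v x)))\<^sup>2) \<partial>unit_interval) < ennreal (\<epsilon> / 4)"
    using uv by (simp flip: of_real_diff)
  have "(\<integral>\<^sup>+x. ennreal ((cmod ((of_real (u x) - of_real (v x)) + (of_real (v x) - p x)))\<^sup>2) \<partial>unit_interval)
      < ennreal \<epsilon>"
    by (rule nn_integral_norm_add_square_less[OF _ _ uv' vp \<open>\<epsilon> > 0\<close>]) auto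
  with p show "\<exists>p. trig_poly p \<and>
      (\<integral>\<^sup>+x. ennreal ((cmod (of_real (u x) - p x))\<^sup>2) \<partial>unit_interval) < ennreal \<epsilon>"
    by auto
qed fact

lemma trig_approximable_cong_AE:
  assumes "trig_approximable v" "u \<in> borel_measurable borel" "AE x in unit_interval. u x = v x"
  shows "trig_approximable u"
proof (rule trig_approximable_limit[OF assms(2)])
  fix \<epsilon> :: real assume "\<epsilon> > 0"
  have "(\<integral>\<^sup>+x. ennreal ((u x - v x)\<^sup>2) \<partial>unit_interval) = (\<integral>\<^sup>+x. 0 \<partial>unit_interval)"
    using assms(3) by (intro nn_integral_cong_AE) auto
  with \<open>\<epsilon> > 0\<close> assms(1) show "\<exists>v. trig_approximable v \<and>
      (\<integral>\<^sup>+x. ennreal ((u x - v x)\<^sup>2) \<partial>unit_interval) < ennreal \<epsilon>"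
    by (intro exI[of _ v]) auto
qed

lemma trig_approximable_of_trig_poly:
  assumes "trig_poly (\<lambda>x. of_real (u x))" "u \<in> borel_measurable borel"
  shows "trig_approximable u"
  unfolding trig_approximable_def using assms by (auto intro!: exI[of _ "\<lambda>x. of_real (u x)"])

lemma trig_approximable_add:
  assumes "trig_approximable u" "trig_approximable v"
  shows "trig_approximable (\<lambda>x. u x + v x)"
  unfolding trig_approximable_def
proof (intro conjI allI impI)
  note [measurable] = assms[unfolded trig_approximable_def, THEN conjunct1]
  show "(\<lambda>x. u x + v x) \<in> borel_measurable borel" by measurable
  fix \<epsilon> :: real assume "\<epsilon> > 0"
  then have e: "\<epsilon> / 4 > 0" by simp
  obtain p q where p: "trig_poly p" "trig_poly q"
    and less: "(\<integral>\<^sup>+x. ennreal ((cmod (of_real (u x) - p x))\<^sup>2) \<partial>unit_interval) < ennreal (\<epsilon> / 4)"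
       "(\<integral>\<^sup>+x. ennreal ((cmod (of_real (v x) - q x))\<^sup>2) \<partial>unit_interval) < ennreal (\<epsilon> / 4)"
    using assms e unfolding trig_approximable_def by blast
  note [measurable] = p[THEN borel_measurable_trig_poly]
  have "(\<integral>\<^sup>+x. ennreal ((cmod ((of_real (u x) - p x) + (of_real (v x) - q x)))\<^sup>2) \<partial>unit_interval)
      < ennreal \<epsilon>"
    by (rule nn_integral_norm_add_square_less[OF _ _ less \<open>\<epsilon> > 0\<close>]) auto
  with p show "\<exists>p. trig_poly p \<and>
      (\<integral>\<^sup>+x. ennreal ((cmod (of_real (u x + v x) - p x))\<^sup>2) \<partial>unit_interval) < ennreal \<epsilon>"
    by (intro exI[of _ "\<lambda>x. p x + q x"]) (auto intro: trig_poly.add simp: algebra_simps)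
qed

lemma trig_approximable_cmult:
  assumes "trig_approximable u"
  shows "trig_approximable (\<lambda>x. c * u x)"
proof (cases "c = 0")
  case True
  then show ?thesis by (auto intro!: trig_approximable_of_trig_poly trig_poly_const)
next
  case False
  note [measurable] = assms[unfolded trig_approximable_def, THEN conjunct1]
  show ?thesis unfolding trig_approximable_def
  proof (intro conjI allI impI)
    show "(\<lambda>x. c * u x) \<in> borel_measurable borel" by measurable
    fix \<epsilon> :: real assume "\<epsilon> > 0"
    then have e: "\<epsilon> / c\<^sup>2 > 0" using False by simp
    obtain p where p: "trig_poly p"
      and less: "(\<integral>\<^sup>+x. ennreal ((cmod (of_real (u x) - p x))\<^sup>2) \<partial>unit_interval) < ennreal (\<epsilon> / c\<^sup>2)"
      using assms e unfolding trig_approximable_def by blast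
    note [measurable] = borel_measurable_trig_poly[OF p]
    have "(\<integral>\<^sup>+x. ennreal ((cmod (of_real (c * u x) - of_real c * p x))\<^sup>2) \<partial>unit_interval)
      = (\<integral>\<^sup>+x. ennreal (c\<^sup>2) * ennreal ((cmod (of_real (u x) - p x))\<^sup>2) \<partial>unit_interval)"
      by (intro nn_integral_cong)
         (simp add: norm_mult power_mult_distrib flip: ennreal_mult' right_diff_distrib)
    also have "\<dots> = ennreal (c\<^sup>2) * (\<integral>\<^sup>+x. ennreal ((cmod (of_real (u x) - p x))\<^sup>2) \<partial>unit_interval)"
      by (rule nn_integral_cmult) measurable
    also have "\<dots> < ennreal (c\<^sup>2) * ennreal (\<epsilon> / c\<^sup>2)"
      using less False by (intro ennreal_mult_strict_left_mono) auto
    also have "\<dots> = ennreal \<epsilon>"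
      using False \<open>\<epsilon> > 0\<close> by (simp flip: ennreal_mult')
    finally show "\<exists>p. trig_poly p \<and>
        (\<integral>\<^sup>+x. ennreal ((cmod (of_real (c * u x) - p x))\<^sup>2) \<partial>unit_interval) < ennreal \<epsilon>"
      using p by (intro exI[of _ "\<lambda>x. of_real c * p x"]) (auto intro: trig_poly_mult trig_poly_const)
  qed
qed

text \<open>The limit also satisfies |u| \<le> w, so the squared errors have the integrable majorant
  4 w^2 and dominated convergence turns pointwise into mean-square convergence.\<close>

lemma trig_approximable_dominated:
  fixes U :: "nat \<Rightarrow> real \<Rightarrow> real"
  assumes U: "\<And>i. trig_approximable (U i)"
    and [measurable]: "u \<in> borel_measurable borel" "w \<in> borel_measurable borel"
    and bound: "\<And>i. AE x in unit_interval. \<bar>U i x\<bar> \<le> w x"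
    and w: "(\<integral>\<^sup>+x. ennreal ((w x)\<^sup>2) \<partial>unit_interval) < \<infinity>"
    and lim: "AE x in unit_interval. (\<lambda>i. U i x) \<longlonglongrightarrow> u x"
  shows "trig_approximable u"
proof (rule trig_approximable_limit)
  have [measurable]: "U i \<in> borel_measurable borel" for i
    using U[of i] by (simp add: trig_approximable_def)
  have all: "AE x in unit_interval. \<forall>i. \<bar>U i x\<bar> \<le> w x"
    unfolding AE_all_countable using bound by blast
  have conv: "(\<lambda>i. \<integral>\<^sup>+x. ennreal ((u x - U i x)\<^sup>2) \<partial>unit_interval) \<longlonglongrightarrow> (\<integral>\<^sup>+x. 0 \<partial>unit_interval)"
  proof (rule nn_integral_dominated_convergence)
    show "(\<integral>\<^sup>+x. ennreal 4 * ennreal ((w x)\<^sup>2) \<partial>unit_interval) < \<infinity>"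
      using w by (subst nn_integral_cmult) (auto simp: ennreal_mult_less_top)
    show "AE x in unit_interval. ennreal ((u x - U i x)\<^sup>2) \<le> ennreal 4 * ennreal ((w x)\<^sup>2)" for i
      using all lim
    proof eventually_elim
      case (elim x)
      have "\<bar>u x\<bar> \<le> w x"
        by (rule LIMSEQ_le_const2[OF tendsto_rabs[OF elim(2)]]) (use elim(1) in auto)
      moreover have "\<bar>U i x\<bar> \<le> w x" using elim(1) by blast
      ultimately have "\<bar>u x - U i x\<bar> \<le> 2 * w x" by linarith
      then have "(u x - U i x)\<^sup>2 \<le> (2 * w x)\<^sup>2"
        by (metis abs_ge_zero power2_abs power_mono)
      then have "ennreal ((u x - U i x)\<^sup>2) \<le> ennreal (4 * (w x)\<^sup>2)"
        by (intro ennreal_leI) (simp add: power_mult_distrib)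
      also have "\<dots> = ennreal 4 * ennreal ((w x)\<^sup>2)" by (rule ennreal_mult) auto
      finally show ?case .
    qed
    show "AE x in unit_interval. (\<lambda>i. ennreal ((u x - U i x)\<^sup>2)) \<longlonglongrightarrow> 0"
      using lim
    proof eventually_elim
      case (elim x)
      have "(\<lambda>i. (u x - U i x)\<^sup>2) \<longlonglongrightarrow> (u x - u x)\<^sup>2"
        by (intro tendsto_intros elim)
      then have "(\<lambda>i. ennreal ((u x - U i x)\<^sup>2)) \<longlonglongrightarrow> ennreal ((u x - u x)\<^sup>2)"
        by (rule tendsto_ennrealI)
      then show ?case by simp
    qed
  qed auto
  fix \<epsilon> :: real assume "\<epsilon> > 0"
  then have "eventually (\<lambda>i. (\<integral>\<^sup>+x. ennreal ((u x - U i x)\<^sup>2) \<partial>unit_interval) < ennreal \<epsilon>) sequentially"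
    using order_tendstoD(2)[OF conv, of "ennreal \<epsilon>"] by simp
  then obtain i where "(\<integral>\<^sup>+x. ennreal ((u x - U i x)\<^sup>2) \<partial>unit_interval) < ennreal \<epsilon>"
    by (auto simp: eventually_sequentially)
  with U show "\<exists>v. trig_approximable v \<and>
      (\<integral>\<^sup>+x. ennreal ((u x - v x)\<^sup>2) \<partial>unit_interval) < ennreal \<epsilon>" by blast
qed fact


text \<open>Bernstein polynomials approximate \<phi> uniformly on \<open>{0..1}\<close>, where the
  normalised cosine takes its values, and a polynomial in a trigonometric polynomial is again
  one.\<close>

lemma trig_approximable_continuous_cos:
  fixes \<phi> :: "real \<Rightarrow> real"
  assumes cont: "continuous_on {0..1} \<phi>" and meas: "\<phi> \<in> borel_measurable borel"
  shows "trig_approximable (\<lambda>x. \<phi> ((1 + cos (2 * pi * (x - a))) / 2))"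
proof -
  define z where "z x = (1 + cos (2 * pi * (x - a))) / 2" for x
  have z01: "z x \<in> {0..1}" for x
  proof -
    have "(1 + c) / 2 \<in> {0..1}" if "- 1 \<le> c" "c \<le> 1" for c :: real
      using that by simp
    from this[OF cos_ge_minus_one cos_le_one] have "(1 + cos t) / 2 \<in> {0..1}" for t :: real .
    then show ?thesis unfolding z_def .
  qed
  have [measurable]: "z \<in> borel_measurable borel"
    unfolding z_def by (intro borel_measurable_continuous_onI continuous_intros) auto
  note [measurable] = meas
  have tz: "trig_poly (\<lambda>x. complex_of_real (z x))"
  proof -
    have "(\<lambda>x. complex_of_real (z x)) = (\<lambda>x. (1 / 2) * (1 + of_real (cos (2 * pi * (x - a)))))"
      by (simp add: z_def fun_eq_iff)
    then show ?thesis
      by (simp only: trig_poly_mult trig_poly_const trig_poly.add trig_poly_cos)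
  qed
  have tz': "trig_poly (\<lambda>x. 1 - complex_of_real (z x))"
    using trig_poly.add[OF trig_poly_const[of 1] trig_poly_mult[OF trig_poly_const[of "- 1"] tz]]
    by simp
  have "trig_approximable (\<lambda>x. \<phi> (z x))"
  proof (rule trig_approximable_limit)
    fix \<epsilon> :: real assume e: "\<epsilon> > 0"
    \<comment> \<open>A uniform error \<open>sqrt (\<epsilon> / 2)\<close> gives squared error at
      most \<epsilon> / 2 on a space of mass one, leaving room for the strict inequality.\<close>
    obtain N where N: "\<And>n x. N \<le> n \<Longrightarrow> x \<in> {0..1} \<Longrightarrow>
        \<bar>\<phi> x - (\<Sum>k\<le>n. \<phi> (real k / real n) * Bernstein n k x)\<bar> < sqrt (\<epsilon> / 2)"
      using Bernstein_Weierstrass[OF cont, of "sqrt (\<epsilon> / 2)"] e by auto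
    define v where "v x = (\<Sum>k\<le>N. \<phi> (real k / real N) * Bernstein N k (z x))" for x
    have [measurable]: "v \<in> borel_measurable borel"
      unfolding v_def Bernstein_def by measurable
    have tp: "trig_poly (\<lambda>x. of_real (\<phi> (real k / real N) * Bernstein N k (z x)))" for k
    proof -
      have "(\<lambda>x. complex_of_real (\<phi> (real k / real N) * Bernstein N k (z x)))
        = (\<lambda>x. (of_real (\<phi> (real k / real N)) * of_nat (N choose k)) *
               (of_real (z x) ^ k * (1 - of_real (z x)) ^ (N - k)))"
        by (simp add: Bernstein_def fun_eq_iff)
      then show ?thesis
        by (simp only: trig_poly_mult trig_poly_const trig_poly_power tz tz')
    qed
    then have "trig_poly (\<lambda>x. \<Sum>k\<le>N. of_real (\<phi> (real k / real N) * Bernstein N k (z x)))"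
      by (intro trig_poly_sum) auto
    then have "trig_approximable v"
      by (intro trig_approximable_of_trig_poly) (auto simp: v_def)
    moreover have "(\<phi> (z x) - v x)\<^sup>2 \<le> \<epsilon> / 2" for x
    proof -
      have "\<bar>\<phi> (z x) - v x\<bar> \<le> sqrt (\<epsilon> / 2)"
        using N[OF order_refl z01[of x]] by (simp add: v_def)
      then have "\<bar>\<phi> (z x) - v x\<bar>\<^sup>2 \<le> (sqrt (\<epsilon> / 2))\<^sup>2"
        by (intro power_mono) auto
      then show ?thesis using e by simp
    qed
    then have "(\<integral>\<^sup>+x. ennreal ((\<phi> (z x) - v x)\<^sup>2) \<partial>unit_interval)
        \<le> (\<integral>\<^sup>+x. ennreal (\<epsilon> / 2) \<partial>unit_interval)"
      by (intro nn_integral_mono ennreal_leI)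
    then have "(\<integral>\<^sup>+x. ennreal ((\<phi> (z x) - v x)\<^sup>2) \<partial>unit_interval) \<le> ennreal (\<epsilon> / 2)"
      by (simp only: nn_integral_const emeasure_unit_interval mult_1_right)
    then have "(\<integral>\<^sup>+x. ennreal ((\<phi> (z x) - v x)\<^sup>2) \<partial>unit_interval) < ennreal \<epsilon>"
      using e by (rule_tac le_less_trans) (auto simp: ennreal_less_iff)
    ultimately show "\<exists>v. trig_approximable v \<and>
        (\<integral>\<^sup>+x. ennreal ((\<phi> (z x) - v x)\<^sup>2) \<partial>unit_interval) < ennreal \<epsilon>" by blast
  qed measurable
  then show ?thesis by (simp add: z_def)
qed

text \<open>The cosine is large near the centre a / 2 of the arc and equals
  \<open>cos (pi * a)\<close> at its two ends. For angles in [-\<pi>, \<pi>] this is monotonicity in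
  the absolute value; larger angles are reflected.\<close>

lemma cos_arc_iff:
  assumes "0 < a" "a \<le> 1" "x \<in> {0..1}"
  shows "cos (2 * pi * (x - a / 2)) > cos (pi * a) \<longleftrightarrow> 0 < x \<and> x < a"
proof (cases "2 * pi * (x - a / 2) \<le> pi")
  case True
  define y where "y = 2 * pi * (x - a / 2)"
  have "pi * a \<le> pi" "pi * x \<ge> 0" using assms by auto
  have y_eq: "y = 2 * (pi * x) - pi * a" by (simp add: y_def algebra_simps)
  have y: "y \<le> pi" using True by (simp add: y_def)
  have "y \<ge> - pi" unfolding y_eq using \<open>pi * a \<le> pi\<close> \<open>pi * x \<ge> 0\<close> by linarith
  have "cos y > cos (pi * a) \<longleftrightarrow> \<bar>y\<bar> < pi * a"
    using cos_mono_less_eq[of "pi * a" "\<bar>y\<bar>"] y \<open>y \<ge> - pi\<close> assms \<open>pi * a \<le> pi\<close> by auto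
  also have "\<dots> \<longleftrightarrow> - (pi * a) < y \<and> y < pi * a" by auto
  also have "y < pi * a \<longleftrightarrow> pi * x < pi * a" by (auto simp: y_def algebra_simps)
  also have "- (pi * a) < y \<longleftrightarrow> pi * 0 < pi * x" by (auto simp: y_def algebra_simps)
  finally show ?thesis by (simp add: y_def zero_less_mult_iff)
next
  case False
  \<comment> \<open>The reflected angle has the same cosine and lies between \<pi> a and \<pi>, so
    the cosine has already dropped to \<open>cos (pi * a)\<close> or below; correspondingly x lies
    to the right of a.\<close>
  define y where "y = 2 * pi - 2 * pi * (x - a / 2)"
  have "pi * a \<le> pi" "pi * x \<le> pi" using assms by auto
  have y_eq: "y = 2 * pi - 2 * (pi * x) + pi * a" by (simp add: y_def algebra_simps)
  have y: "y < pi" using False by (simp add: y_def)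
  have "y \<ge> pi * a" unfolding y_eq using \<open>pi * x \<le> pi\<close> by linarith
  have "cos y \<le> cos (pi * a)"
    using y \<open>y \<ge> pi * a\<close> assms by (intro cos_monotone_0_pi_le) auto
  moreover have "cos y = cos (2 * pi * (x - a / 2))"
    unfolding y_def by (simp add: cos_diff)
  moreover have "pi * a < pi * x"
    using y \<open>pi * a \<le> pi\<close> unfolding y_eq by linarith
  then have "a < x" by simp
  ultimately show ?thesis by auto
qed

lemma AE_unit_interval_neq: "AE x in unit_interval. x \<noteq> c"
  using AE_lborel_singleton[of c] by (subst AE_restrict_space_iff) auto

text \<open>On the unit interval \<open>{0<..<a}\<close> is a superlevel set of \<open>cos (2 \<pi> (x - a / 2))\<close>, so its
  indicator is a limit of continuous functions of that cosine.\<close>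
lemma trig_approximable_lessThan: "trig_approximable (indicator {..<a})"
proof -
  consider "a \<le> 0" | "a > 1" | "0 < a" "a \<le> 1" by linarith
  then show ?thesis
  proof cases
    case 1
    then show ?thesis
      by (intro trig_approximable_cong_AE[OF trig_approximable_of_trig_poly[of "\<lambda>_. 0"]])
         (auto intro: trig_poly_const AE_I2 simp: space_restrict_space)
  next
    case 2
    then show ?thesis
      by (intro trig_approximable_cong_AE[OF trig_approximable_of_trig_poly[of "\<lambda>_. 1"]])
         (auto intro: trig_poly_const AE_I2 simp: space_restrict_space)
  next
    case 3
    define z where "z x = (1 + cos (2 * pi * (x - a / 2))) / 2" for x
    \<comment> \<open>\<open>t\<close> is the value of \<open>z\<close> at both ends 0 and a of the
      arc. \<open>\<phi> k\<close> is a ramp of slope k starting at t and clipped to [0, 1], so it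
      tends to the indicator of values above t.\<close>
    define t where "t = (1 + cos (pi * a)) / 2"
    define \<phi> where "\<phi> k y = min 1 (max 0 (real k * (y - t)))" for k y
    have \<phi>: "continuous_on S (\<phi> k)" for S k
      unfolding \<phi>_def by (intro continuous_intros)
    show ?thesis
    proof (rule trig_approximable_dominated)
      show "trig_approximable (\<lambda>x. \<phi> k (z x))" for k
        unfolding z_def
        by (intro trig_approximable_continuous_cos \<phi> borel_measurable_continuous_onI)
      show "AE x in unit_interval. \<bar>\<phi> k (z x)\<bar> \<le> 1" for k
        by (auto simp: \<phi>_def)
      show "(\<integral>\<^sup>+x. ennreal (1\<^sup>2) \<partial>unit_interval) < \<infinity>"
        by (simp add: emeasure_restrict_space space_restrict_space)
      \<comment> \<open>The point 0 must be left out: there \<open>z\<close> equals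
        \<open>t\<close>, so every ramp gives 0 although 0 < a.\<close>
      show "AE x in unit_interval. (\<lambda>k. \<phi> k (z x)) \<longlonglongrightarrow> indicator {..<a} x"
        using AE_unit_interval_neq[of 0] AE_space
      proof eventually_elim
        case (elim x)
        then have x: "x \<in> {0..1}" "x > 0" by (auto simp: space_restrict_space)
        have iff: "z x > t \<longleftrightarrow> x < a"
          using cos_arc_iff[OF 3 x(1)] x(2) by (auto simp: z_def t_def)
        show ?case
        proof (cases "x < a")
          case True
          with iff have d: "z x - t > 0" by simp
          obtain n where n: "1 / (z x - t) \<le> real n" using real_arch_simple by blast
          have "\<phi> k (z x) = 1" if "k \<ge> n" for k
          proof -
            have "1 / (z x - t) \<le> real k" using n that by linarith
            then have "1 \<le> real k * (z x - t)" using d by (simp add: field_simps)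
            then show ?thesis by (simp add: \<phi>_def)
          qed
          with True show ?thesis
            by (intro tendsto_eventually) (auto simp: eventually_sequentially)
        next
          case False
          with iff have "real k * (z x - t) \<le> 0" for k
            by (intro mult_nonneg_nonpos) auto
          with False show ?thesis by (simp add: \<phi>_def)
        qed
      qed
    qed auto
  qed
qed

section \<open>From half-lines to Borel sets and square integrable functions\<close>

lemma trig_approximable_sum:
  "finite A \<Longrightarrow> (\<And>i. i \<in> A \<Longrightarrow> trig_approximable (u i)) \<Longrightarrow> trig_approximable (\<lambda>x. \<Sum>i\<in>A. u i x)"
  by (induction A rule: finite_induct)
     (auto intro: trig_approximable_add trig_approximable_of_trig_poly trig_poly_const)

text \<open>Dynkin's theorem: half-lines are stable under intersection and generate the Borel sets,
  and the sets with approximable indicator are closed under complements and countable disjoint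
  unions.\<close>

lemma trig_approximable_indicator:
  assumes "A \<in> sets borel"
  shows "trig_approximable (indicator A)"
proof -
  have "Int_stable (range lessThan :: real set set)"
  proof (rule Int_stableI_image)
    show "\<exists>c\<in>UNIV. {..<a} \<inter> {..<b} = {..<c}" for a b :: real
      by (intro bexI[of _ "min a b"]) auto
  qed
  moreover have "range lessThan \<subseteq> Pow (UNIV :: real set)" by simp
  moreover have sets: "sigma_sets UNIV (range lessThan) = sets (borel :: real measure)"
    unfolding borel_Iio by (rule sets_measure_of[symmetric]) auto
  then have "A \<in> sigma_sets UNIV (range lessThan)" using assms by simp
  ultimately show ?thesis
  proof (induction rule: sigma_sets_induct_disjoint[where \<Omega> = UNIV])
    case (basic A)
    then show ?case using trig_approximable_lessThan by auto
  next
    case empty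
    have "indicator {} = (\<lambda>_::real. 0::real)" by auto
    then show ?case by (auto intro: trig_approximable_of_trig_poly trig_poly_const)
  next
    case (compl A)
    have "indicator (UNIV - A) = (\<lambda>x. (1::real) + (- 1) * indicator A x)"
      by (auto simp: indicator_def fun_eq_iff)
    moreover have "trig_approximable (\<lambda>x. 1 + (- 1) * indicator A x)"
      by (rule trig_approximable_add[OF trig_approximable_of_trig_poly trig_approximable_cmult[OF compl(2)]])
         (auto intro: trig_poly_const)
    ultimately show ?case by (simp only:)
  next
    case (union A)
    note [measurable] = union(2)[unfolded sets, THEN subsetD, OF rangeI]
    have eq: "(\<Sum>i<n. indicator (A i) x) = (indicator (\<Union>i<n. A i) x :: real)" for n x
      using union(1) by (intro indicator_UN_disjoint[symmetric]) (auto simp: disjoint_family_on_def)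
    show ?case
    proof (rule trig_approximable_dominated[where w = "\<lambda>_. 1"])
      show "trig_approximable (\<lambda>x. \<Sum>i<n. indicator (A i) x)" for n
        using union(3) by (intro trig_approximable_sum) auto
      show "AE x in unit_interval. \<bar>\<Sum>i<n. indicator (A i) x\<bar> \<le> (1::real)" for n
        unfolding eq by (simp add: indicator_def)
      show "AE x in unit_interval. (\<lambda>n. \<Sum>i<n. indicator (A i) x) \<longlonglongrightarrow> (indicator (\<Union>i. A i) x :: real)"
        unfolding eq by (intro AE_I2 LIMSEQ_indicator_UN)
    qed (auto simp: emeasure_restrict_space space_restrict_space)
  qed
qed

lemma nn_integral_square_finite_mono:
  fixes u v :: "'a \<Rightarrow> real"
  assumes "\<And>x. \<bar>v x\<bar> \<le> \<bar>u x\<bar>" "(\<integral>\<^sup>+x. ennreal ((u x)\<^sup>2) \<partial>M) < \<infinity>"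
  shows "(\<integral>\<^sup>+x. ennreal ((v x)\<^sup>2) \<partial>M) < \<infinity>"
  using assms(1)
  by (intro le_less_trans[OF nn_integral_mono assms(2)] ennreal_leI) (simp flip: abs_le_square_iff)

text \<open>Induction over nonnegative measurable functions. Square integrability descends to the
  summands and to the approximants because each of them is pointwise bounded by the function it
  builds up.\<close>

lemma trig_approximable_nonneg:
  assumes "u \<in> borel_measurable borel" "\<And>x. 0 \<le> u x"
    and "(\<integral>\<^sup>+x. ennreal ((u x)\<^sup>2) \<partial>unit_interval) < \<infinity>"
  shows "trig_approximable u"
  using assms
proof (induction rule: borel_measurable_induct_real)
  case (set A)
  then show ?case by (intro trig_approximable_indicator)
next
  case (mult u c)
  show ?case
  \<comment> \<open>For c = 0 the finiteness for c u says nothing about u, so the induction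
    hypothesis is reached only after dividing by a nonzero c.\<close>
  proof (cases "c = 0")
    case True
    then show ?thesis by (auto intro!: trig_approximable_of_trig_poly trig_poly_const)
  next
    case False
    have "ennreal (c\<^sup>2) * (\<integral>\<^sup>+x. ennreal ((u x)\<^sup>2) \<partial>unit_interval) < \<infinity>"
      using mult.prems mult.hyps
      by (subst nn_integral_cmult[symmetric]) (auto simp: power_mult_distrib ennreal_mult')
    then have "(\<integral>\<^sup>+x. ennreal ((u x)\<^sup>2) \<partial>unit_interval) < \<infinity>"
      using False by (auto simp: ennreal_mult_less_top)
    with mult show ?thesis by (intro trig_approximable_cmult) auto
  qed
next
  case (add u v)
  have "(\<integral>\<^sup>+x. ennreal ((u x)\<^sup>2) \<partial>unit_interval) < \<infinity>" "(\<integral>\<^sup>+x. ennreal ((v x)\<^sup>2) \<partial>unit_interval) < \<infinity>"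
    using add.hyps(2,4) by (intro nn_integral_square_finite_mono[OF _ add.prems]; simp)+
  with add show ?case by (intro trig_approximable_add) auto
next
  case (seq U)
  have le: "U i x \<le> u x" for i x
  proof (rule LIMSEQ_le_const[OF seq.hyps(4)])
    show "\<exists>N. \<forall>n\<ge>N. U i x \<le> U n x"
      using seq.hyps(3) by (auto simp: incseq_def le_fun_def)
  qed simp
  have "(\<integral>\<^sup>+x. ennreal ((U i x)\<^sup>2) \<partial>unit_interval) < \<infinity>" for i
    using seq.hyps(2) le assms(2) by (intro nn_integral_square_finite_mono[OF _ seq.prems]) simp
  then have "trig_approximable (U i)" for i by (rule seq.IH)
  then show ?case
  proof (rule trig_approximable_dominated[OF _ assms(1,1)])
    show "AE x in unit_interval. \<bar>U i x\<bar> \<le> u x" for i using le seq.hyps(2) by simp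
    show "AE x in unit_interval. (\<lambda>i. U i x) \<longlonglongrightarrow> u x" using seq.hyps(4) by simp
  qed (rule seq.prems)
qed

lemma trig_approximable_square_integrable:
  assumes [measurable]: "u \<in> borel_measurable borel"
    and fin: "(\<integral>\<^sup>+x. ennreal ((u x)\<^sup>2) \<partial>unit_interval) < \<infinity>"
  shows "trig_approximable u"
proof -
  have "(\<integral>\<^sup>+x. ennreal ((max 0 (u x))\<^sup>2) \<partial>unit_interval) < \<infinity>"
    "(\<integral>\<^sup>+x. ennreal ((max 0 (- u x))\<^sup>2) \<partial>unit_interval) < \<infinity>"
    by (rule nn_integral_square_finite_mono[OF _ fin], simp)+
  then have "trig_approximable (\<lambda>x. max 0 (u x))" "trig_approximable (\<lambda>x. max 0 (- u x))"
    by (intro trig_approximable_nonneg; simp)+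
  then have "trig_approximable (\<lambda>x. max 0 (u x) + (- 1) * max 0 (- u x))"
    by (intro trig_approximable_add trig_approximable_cmult)
  also have "(\<lambda>x. max 0 (u x) + (- 1) * max 0 (- u x)) = u" by (auto simp: fun_eq_iff max_def)
  finally show ?thesis .
qed

section \<open>Fourier partial sums\<close>

text \<open>Orthogonality leaves in the expanded square only the pairs of equal frequency. Each
  product is bounded by half the sum of the two squares, and by symmetry both halves give the same
  sum, in which every index is counted with the multiplicity of its frequency.\<close>

lemma nn_integral_exponential_sum_le:
  fixes \<nu> :: "'i \<Rightarrow> int" and b :: "'i \<Rightarrow> complex"
  assumes "finite J"
  shows "(\<integral>\<^sup>+x. ennreal ((cmod (\<Sum>i\<in>J. b i * fchar (\<nu> i) x))\<^sup>2) \<partial>unit_interval)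
    \<le> ennreal (\<Sum>i\<in>J. (cmod (b i))\<^sup>2 * real (card {j\<in>J. \<nu> j = \<nu> i}))"
proof -
  let ?p = "\<lambda>x. \<Sum>i\<in>J. b i * fchar (\<nu> i) x"
  let ?t = "\<lambda>i j x. b i * cnj (b j) * fchar (\<nu> i - \<nu> j) x"
  have sq: "complex_of_real ((cmod (?p x))\<^sup>2) = (\<Sum>i\<in>J. \<Sum>j\<in>J. ?t i j x)" for x
    unfolding complex_norm_square cnj_sum sum_product
    by (simp add: cnj_fchar diff_conv_add_uminus fchar_add mult_ac del: add_uminus_conv_diff)
  have int_t: "integrable unit_interval (\<lambda>x. ?t i j x)" for i j
    by (rule integrable_unit_interval_bounded[where B = "cmod (b i * cnj (b j))"])
       (auto simp: norm_mult)
  have "integrable unit_interval (\<lambda>x. complex_of_real ((cmod (?p x))\<^sup>2))"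
    unfolding sq using int_t by (intro Bochner_Integration.integrable_sum)
  then have int: "integrable unit_interval (\<lambda>x. (cmod (?p x))\<^sup>2)"
    by (simp only: complex_of_real_integrable_eq)
  define I where "I = (LINT x|unit_interval. (cmod (?p x))\<^sup>2)"
  have "complex_of_real I = (LINT x|unit_interval. (\<Sum>i\<in>J. \<Sum>j\<in>J. ?t i j x))"
    unfolding I_def integral_complex_of_real[symmetric] sq ..
  also have "\<dots> = (\<Sum>i\<in>J. \<Sum>j\<in>J. LINT x|unit_interval. ?t i j x)"
    using int_t by (simp add: Bochner_Integration.integral_sum Bochner_Integration.integrable_sum)
  also have "\<dots> = (\<Sum>i\<in>J. \<Sum>j\<in>J. if \<nu> j = \<nu> i then b i * cnj (b j) else 0)"
    by (intro sum.cong refl) (auto simp: integral_fchar)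
  finally have I: "complex_of_real I = (\<Sum>i\<in>J. \<Sum>j\<in>J. if \<nu> j = \<nu> i then b i * cnj (b j) else 0)" .
  have "I \<le> cmod (complex_of_real I)" by simp
  also have "\<dots> \<le> (\<Sum>i\<in>J. \<Sum>j\<in>J. cmod (if \<nu> j = \<nu> i then b i * cnj (b j) else 0))"
    unfolding I by (intro order_trans[OF norm_sum] sum_mono) simp
  also have "\<dots> \<le> (\<Sum>i\<in>J. \<Sum>j\<in>J. if \<nu> j = \<nu> i then ((cmod (b i))\<^sup>2 + (cmod (b j))\<^sup>2) / 2 else 0)"
  proof (intro sum_mono)
    fix i j
    show "cmod (if \<nu> j = \<nu> i then b i * cnj (b j) else 0)
        \<le> (if \<nu> j = \<nu> i then ((cmod (b i))\<^sup>2 + (cmod (b j))\<^sup>2) / 2 else 0)"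
      using sum_squares_bound[of "cmod (b i)" "cmod (b j)"] by (simp add: norm_mult field_simps)
  qed
  also have "\<dots> = (\<Sum>i\<in>J. \<Sum>j\<in>J. if \<nu> j = \<nu> i then (cmod (b i))\<^sup>2 / 2 else 0)
      + (\<Sum>i\<in>J. \<Sum>j\<in>J. if \<nu> i = \<nu> j then (cmod (b j))\<^sup>2 / 2 else 0)"
    unfolding sum.distrib[symmetric] by (intro sum.cong refl) (auto simp: add_divide_distrib)
  also have "(\<Sum>i\<in>J. \<Sum>j\<in>J. if \<nu> i = \<nu> j then (cmod (b j))\<^sup>2 / 2 else 0)
      = (\<Sum>i\<in>J. \<Sum>j\<in>J. if \<nu> j = \<nu> i then (cmod (b i))\<^sup>2 / 2 else 0)"
    by (rule sum.swap)
  also have "(\<Sum>i\<in>J. \<Sum>j\<in>J. if \<nu> j = \<nu> i then (cmod (b i))\<^sup>2 / 2 else 0)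
      = (\<Sum>i\<in>J. (cmod (b i))\<^sup>2 * real (card {j\<in>J. \<nu> j = \<nu> i}) / 2)"
    using assms by (intro sum.cong refl) (simp add: sum.inter_filter[symmetric])
  finally have "I \<le> (\<Sum>i\<in>J. (cmod (b i))\<^sup>2 * real (card {j\<in>J. \<nu> j = \<nu> i}))"
    by (simp add: sum_divide_distrib[symmetric])
  then show ?thesis
    using int unfolding I_def by (subst nn_integral_eq_integral) (auto intro: ennreal_leI)
qed

section \<open>Fourier coefficients, Bessel's inequality and mean-square convergence\<close>

lemma integrable_L2_torus:
  assumes "L2_torus f"
  shows "f \<in> borel_measurable borel" "integrable unit_interval (\<lambda>x. (f x)\<^sup>2)"
    "integrable unit_interval f"
proof -
  show [measurable]: "f \<in> borel_measurable borel"
    using assms by (simp add: L2_torus_def)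
  show sq: "integrable unit_interval (\<lambda>x. (f x)\<^sup>2)"
    using assms by (simp add: L2_torus_def set_integrable_def integrable_restrict_space)
  have "integrable unit_interval (\<lambda>x. 1 + (f x)\<^sup>2)"
    by (rule Bochner_Integration.integrable_add[OF integrable_unit_interval_bounded[where B = 1] sq]) auto
  then show "integrable unit_interval f"
  proof (rule Bochner_Integration.integrable_bound)
    have "\<bar>y\<bar> \<le> 1 + y\<^sup>2" for y :: real
    proof -
      have "0 \<le> (\<bar>y\<bar> - 1)\<^sup>2" by simp
      then have "2 * \<bar>y\<bar> \<le> 1 + y\<^sup>2" by (simp add: power2_diff)
      then show ?thesis by linarith
    qed
    then show "AE x in unit_interval. norm (f x) \<le> norm (1 + (f x)\<^sup>2)"
      by (intro AE_I2) (simp add: order_trans[OF _ abs_ge_self])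
  qed simp
qed

lemma integrable_mult_fchar:
  assumes "L2_torus f"
  shows "integrable unit_interval (\<lambda>x. complex_of_real (f x) * fchar l x)"
proof (rule Bochner_Integration.integrable_bound[OF integrable_L2_torus(3)[OF assms]])
  have [measurable]: "f \<in> borel_measurable borel" by (rule integrable_L2_torus(1)[OF assms])
  show "(\<lambda>x. complex_of_real (f x) * fchar l x) \<in> borel_measurable unit_interval" by measurable
qed (simp add: norm_mult)

lemma fcoef_eq: "fcoef f l = (LINT x|unit_interval. complex_of_real (f x) * fchar (- l) x)"
  by (simp add: fcoef_def set_lebesgue_integral_def integral_restrict_space fchar_def)

text \<open>Holds because f is real valued.\<close>

lemma fcoef_uminus: "fcoef f (- l) = cnj (fcoef f l)"
proof -
  have "cnj (LINT x|unit_interval. complex_of_real (f x) * fchar (- l) x)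
      = (LINT x|unit_interval. cnj (complex_of_real (f x) * fchar (- l) x))"
    by (rule Bochner_Integration.integral_cnj[symmetric])
  also have "\<dots> = (LINT x|unit_interval. complex_of_real (f x) * fchar l x)"
    by (simp add: cnj_fchar del: Bochner_Integration.integral_cnj)
  finally show ?thesis by (simp add: fcoef_eq)
qed

text \<open>Expanding the square and completing it in the coefficients b. The last sum vanishes
  exactly when b agrees with the Fourier coefficients on A, which yields both Bessel's inequality
  and the best approximation property.\<close>

lemma integral_square_diff_trig:
  assumes f: "L2_torus f" and A: "finite A"
  shows "integrable unit_interval (\<lambda>x. (cmod (f x - (\<Sum>l\<in>A. b l * fchar l x)))\<^sup>2)" (is ?int)
    and "(LINT x|unit_interval. (cmod (f x - (\<Sum>l\<in>A. b l * fchar l x)))\<^sup>2)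
      = (LINT x|unit_interval. (f x)\<^sup>2) - (\<Sum>l\<in>A. (cmod (fcoef f l))\<^sup>2)
        + (\<Sum>l\<in>A. (cmod (fcoef f l - b l))\<^sup>2)" (is "?I = ?r")
proof -
  let ?g = "\<lambda>x. complex_of_real ((f x)\<^sup>2) - (\<Sum>l\<in>A. cnj (b l) * (complex_of_real (f x) * fchar (- l) x))
    - (\<Sum>l\<in>A. b l * (complex_of_real (f x) * fchar l x))
    + (\<Sum>l\<in>A. \<Sum>k\<in>A. b l * cnj (b k) * fchar (l - k) x)"
  have eq: "complex_of_real ((cmod (f x - (\<Sum>l\<in>A. b l * fchar l x)))\<^sup>2) = ?g x" for x
  proof -
    define p where "p = (\<Sum>l\<in>A. b l * fchar l x)"
    have "complex_of_real ((cmod (f x - p))\<^sup>2)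
      = complex_of_real ((f x)\<^sup>2) - cnj p * f x - p * f x + p * cnj p"
      unfolding complex_norm_square by (simp add: algebra_simps power2_eq_square)
    also have "p * f x = (\<Sum>l\<in>A. b l * (complex_of_real (f x) * fchar l x))"
      unfolding p_def sum_distrib_right by (simp add: mult_ac)
    also have "cnj p * f x = (\<Sum>l\<in>A. cnj (b l) * (complex_of_real (f x) * fchar (- l) x))"
      unfolding p_def cnj_sum sum_distrib_right by (simp add: mult_ac cnj_fchar)
    also have "p * cnj p = (\<Sum>l\<in>A. \<Sum>k\<in>A. b l * cnj (b k) * fchar (l - k) x)"
      unfolding p_def cnj_sum sum_product
      by (simp add: cnj_fchar diff_conv_add_uminus fchar_add mult_ac del: add_uminus_conv_diff)
    finally show ?thesis by (simp add: p_def)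
  qed
  have i1: "integrable unit_interval (\<lambda>x. complex_of_real ((f x)\<^sup>2))"
    using integrable_L2_torus[OF f] by (simp only: complex_of_real_integrable_eq)
  have i2: "integrable unit_interval (\<lambda>x. cnj (b l) * (complex_of_real (f x) * fchar (- l) x))" for l
    using integrable_mult_fchar[OF f] by (intro integrable_mult_right)
  have i3: "integrable unit_interval (\<lambda>x. b l * (complex_of_real (f x) * fchar l x))" for l
    using integrable_mult_fchar[OF f] by (intro integrable_mult_right)
  have i4: "integrable unit_interval (\<lambda>x. b l * cnj (b k) * fchar (l - k) x)" for l k
    by (rule integrable_unit_interval_bounded[where B = "cmod (b l * cnj (b k))"])
       (auto simp: norm_mult)
  have "integrable unit_interval ?g"
    by (intro Bochner_Integration.integrable_add Bochner_Integration.integrable_diff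
        Bochner_Integration.integrable_sum i1 i2 i3 i4)
  then show ?int unfolding eq[symmetric] by (simp only: complex_of_real_integrable_eq)
  have "complex_of_real ?I = (LINT x|unit_interval. ?g x)"
    unfolding integral_complex_of_real[symmetric] eq ..
  also have "\<dots> = complex_of_real (LINT x|unit_interval. (f x)\<^sup>2)
      - (\<Sum>l\<in>A. cnj (b l) * fcoef f l) - (\<Sum>l\<in>A. b l * fcoef f (- l))
      + (\<Sum>l\<in>A. \<Sum>k\<in>A. b l * cnj (b k) * (if l - k = 0 then 1 else 0))"
  proof -
    note sums = Bochner_Integration.integrable_sum[of A, OF i2]
      Bochner_Integration.integrable_sum[of A, OF i3]
      Bochner_Integration.integrable_sum[of A, OF Bochner_Integration.integrable_sum[of A, OF i4]]
    have "(LINT x|unit_interval. ?g x) = (LINT x|unit_interval. complex_of_real ((f x)\<^sup>2))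
      - (\<Sum>l\<in>A. LINT x|unit_interval. cnj (b l) * (complex_of_real (f x) * fchar (- l) x))
      - (\<Sum>l\<in>A. LINT x|unit_interval. b l * (complex_of_real (f x) * fchar l x))
      + (\<Sum>l\<in>A. \<Sum>k\<in>A. LINT x|unit_interval. b l * cnj (b k) * fchar (l - k) x)"
      by (simp only: Bochner_Integration.integral_add Bochner_Integration.integral_diff
        Bochner_Integration.integrable_diff Bochner_Integration.integral_sum
        Bochner_Integration.integrable_sum sums i1 i2 i3 i4)
    then show ?thesis
      by (simp only: integral_complex_of_real integral_mult_right_zero integral_fchar fcoef_eq minus_minus)
  qed
  also have "(\<Sum>l\<in>A. \<Sum>k\<in>A. b l * cnj (b k) * (if l - k = 0 then 1 else 0)) = (\<Sum>l\<in>A. b l * cnj (b l))"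
    using A by (intro sum.cong refl) (simp add: if_distrib cong: if_cong)
  also have "complex_of_real (LINT x|unit_interval. (f x)\<^sup>2)
      - (\<Sum>l\<in>A. cnj (b l) * fcoef f l) - (\<Sum>l\<in>A. b l * fcoef f (- l)) + (\<Sum>l\<in>A. b l * cnj (b l))
      = complex_of_real ?r"
    by (simp add: complex_norm_square fcoef_uminus algebra_simps sum.distrib sum_subtractf
        del: of_real_power)
  finally show "?I = ?r" by (simp only: of_real_eq_iff)
qed

lemma Bessel_inequality:
  assumes "L2_torus f" "finite A"
  shows "(\<Sum>l\<in>A. (cmod (fcoef f l))\<^sup>2) \<le> (LINT x|unit_interval. (f x)\<^sup>2)"
proof -
  have "0 \<le> (LINT x|unit_interval. (cmod (f x - (\<Sum>l\<in>A. fcoef f l * fchar l x)))\<^sup>2)"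
    by (rule integral_nonneg_AE) simp
  then show ?thesis by (simp add: integral_square_diff_trig(2)[OF assms])
qed

text \<open>Take a trigonometric polynomial close to f and N beyond all of its frequencies; among
  trigonometric polynomials with frequencies up to N the Fourier partial sum is at least as
  close.\<close>

lemma fourier_partial_sum_converges:
  assumes f: "L2_torus f" and "\<epsilon> > 0"
  shows "\<exists>N :: nat. (\<integral>\<^sup>+x. ennreal ((cmod (f x - (\<Sum>l\<in>{- int N..int N}. fcoef f l * fchar l x)))\<^sup>2)
    \<partial>unit_interval) < ennreal \<epsilon>"
proof -
  note meas = integrable_L2_torus(1)[OF f] and sq = integrable_L2_torus(2)[OF f]
  have "(\<integral>\<^sup>+x. ennreal ((f x)\<^sup>2) \<partial>unit_interval) < \<infinity>"
    using sq by (simp add: nn_integral_eq_integral)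
  then have "trig_approximable f"
    by (rule trig_approximable_square_integrable[OF meas])
  then obtain p where "trig_poly p"
    and p: "(\<integral>\<^sup>+x. ennreal ((cmod (of_real (f x) - p x))\<^sup>2) \<partial>unit_interval) < ennreal \<epsilon>"
    using \<open>\<epsilon> > 0\<close> unfolding trig_approximable_def by blast
  then obtain A b where A: "finite A" and pA: "p = (\<lambda>x. \<Sum>l\<in>A. b l * fchar l x)"
    using trig_poly_normal_form by blast
  obtain N where N: "\<And>l. l \<in> A \<Longrightarrow> nat \<bar>l\<bar> \<le> N"
    using A by (metis finite_imageI finite_nat_set_iff_bounded_le imageI)
  define B where "B = {- int N..int N}"
  define b' where "b' l = (if l \<in> A then b l else 0)" for l
  have "A \<subseteq> B" using N unfolding B_def by force
  then have p_eq: "p = (\<lambda>x. \<Sum>l\<in>B. b' l * fchar l x)"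
    unfolding pA b'_def by (intro ext sum.mono_neutral_cong_left) (auto simp: B_def)
  have B: "finite B" by (simp add: B_def)
  have "(\<integral>\<^sup>+x. ennreal ((cmod (f x - (\<Sum>l\<in>B. fcoef f l * fchar l x)))\<^sup>2) \<partial>unit_interval)
    = ennreal (LINT x|unit_interval. (cmod (f x - (\<Sum>l\<in>B. fcoef f l * fchar l x)))\<^sup>2)"
    using integral_square_diff_trig(1)[OF f B] by (intro nn_integral_eq_integral) auto
  also have "\<dots> \<le> ennreal (LINT x|unit_interval. (cmod (f x - (\<Sum>l\<in>B. b' l * fchar l x)))\<^sup>2)"
    unfolding integral_square_diff_trig(2)[OF f B] by (intro ennreal_leI) (auto intro: sum_nonneg)
  also have "\<dots> = (\<integral>\<^sup>+x. ennreal ((cmod (f x - (\<Sum>l\<in>B. b' l * fchar l x)))\<^sup>2) \<partial>unit_interval)"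
    using integral_square_diff_trig(1)[OF f B] by (intro nn_integral_eq_integral[symmetric]) auto
  also have "\<dots> < ennreal \<epsilon>" using p by (simp add: p_eq)
  finally show ?thesis unfolding B_def by blast
qed

section \<open>Invariance of integrals of periodic functions under dilation\<close>

lemma nn_integral_unit_interval_eq:
  fixes u :: "real \<Rightarrow> ennreal"
  assumes [measurable]: "u \<in> borel_measurable borel"
  shows "(\<integral>\<^sup>+x. u x \<partial>unit_interval) = (\<integral>\<^sup>+x. u x * indicator {0..<1} x \<partial>lborel)"
proof -
  have "(\<integral>\<^sup>+x. u x \<partial>unit_interval) = (\<integral>\<^sup>+x. u x * indicator {0..1} x \<partial>lborel)"
    by (intro nn_integral_restrict_space) auto
  also have "\<dots> = (\<integral>\<^sup>+x. u x * indicator {0..<1} x \<partial>lborel)"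
    using AE_lborel_singleton[of "1 :: real"]
    by (intro nn_integral_cong_AE) (auto elim!: eventually_mono simp: indicator_def)
  finally show ?thesis .
qed

text \<open>The substitution x to k x carries [0, 1) to [0, k), which consists of k full periods,
  and its Jacobian 1/k compensates. Half-open intervals are used so that the periods tile without
  overlap.\<close>

lemma nn_integral_dilate:
  fixes u :: "real \<Rightarrow> ennreal"
  assumes [measurable]: "u \<in> borel_measurable borel" and per: "\<And>x. u (x + 1) = u x" and "k > 0"
  shows "(\<integral>\<^sup>+x. u (real k * x) \<partial>unit_interval) = (\<integral>\<^sup>+x. u x \<partial>unit_interval)"
proof -
  have per': "u (x + real i) = u x" for x i
  proof (induction i)
    case (Suc i)
    have "u (x + real (Suc i)) = u ((x + real i) + 1)" by (simp add: add_ac)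
    with Suc per show ?case by simp
  qed simp
  have shift: "(\<integral>\<^sup>+x. u x * indicator {real i..<real (Suc i)} x \<partial>lborel) = (\<integral>\<^sup>+x. u x \<partial>unit_interval)" for i
  proof -
    have "(\<integral>\<^sup>+x. u x * indicator {real i..<real (Suc i)} x \<partial>lborel)
      = (\<integral>\<^sup>+x. u (real i + 1 * x) * indicator {real i..<real (Suc i)} (real i + 1 * x) \<partial>lborel)"
      using nn_integral_real_affine[of "\<lambda>x. u x * indicator {real i..<real (Suc i)} x" 1 "real i"]
      by simp
    also have "\<dots> = (\<integral>\<^sup>+x. u x * indicator {0..<1} x \<partial>lborel)"
      using per' by (intro nn_integral_cong) (auto simp: indicator_def add.commute)
    finally show ?thesis by (simp add: nn_integral_unit_interval_eq)
  qed
  have sum_ind: "indicator {0..<real n} x = (\<Sum>i<n. indicator {real i..<real (Suc i)} x :: ennreal)" for n x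
  proof (induction n)
    case (Suc n)
    have "indicator {0..<real (Suc n)} x
        = (indicator {0..<real n} x + indicator {real n..<real (Suc n)} x :: ennreal)"
      by (auto simp: indicator_def)
    with Suc show ?case by simp
  qed simp
  have "(\<integral>\<^sup>+x. u (real k * x) \<partial>unit_interval) = (\<integral>\<^sup>+x. u (real k * x) * indicator {0..<1} x \<partial>lborel)"
    by (rule nn_integral_unit_interval_eq) measurable
  also have "\<dots> = ennreal (1 / real k) *
      (\<integral>\<^sup>+x. u (real k * (x / real k)) * indicator {0..<1} (x / real k) \<partial>lborel)"
    using nn_integral_real_affine[of "\<lambda>x. u (real k * x) * indicator {0..<1} x" "1 / real k" 0] \<open>k > 0\<close>
    by simp
  also have "(\<integral>\<^sup>+x. u (real k * (x / real k)) * indicator {0..<1} (x / real k) \<partial>lborel)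
      = (\<integral>\<^sup>+x. u x * indicator {0..<real k} x \<partial>lborel)"
    using \<open>k > 0\<close> by (intro nn_integral_cong) (auto simp: indicator_def field_simps)
  also have "\<dots> = (\<Sum>i<k. \<integral>\<^sup>+x. u x * indicator {real i..<real (Suc i)} x \<partial>lborel)"
    unfolding sum_ind sum_distrib_left by (rule nn_integral_sum) measurable
  also have "\<dots> = of_nat k * (\<integral>\<^sup>+x. u x \<partial>unit_interval)"
    unfolding shift by simp
  also have "ennreal (1 / real k) * (of_nat k * (\<integral>\<^sup>+x. u x \<partial>unit_interval))
      = (\<integral>\<^sup>+x. u x \<partial>unit_interval)"
    using \<open>k > 0\<close> by (simp add: ennreal_of_nat_eq_real_of_nat mult.assoc[symmetric] flip: ennreal_mult')
  finally show ?thesis .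
qed

section \<open>Quasi-orthogonality of dilates\<close>

text \<open>Cancel the gcd on both sides; the cofactors are coprime. This decides when the frequency
  l m of the m-th dilate is a multiple of n, as it must be to occur in the n-th dilate.\<close>

lemma gcd_cofactor_dvd_iff:
  fixes m n :: nat and l :: int
  assumes "m > 0"
  shows "int n dvd l * int m \<longleftrightarrow> int (n div gcd m n) dvd l"
proof -
  define d u v where "d = gcd m n" and "u = m div gcd m n" and "v = n div gcd m n"
  have d: "d > 0" and m: "m = u * d" and n: "n = v * d" and "coprime u v"
    using assms by (auto simp: d_def u_def v_def div_gcd_coprime)
  have "int n dvd l * int m \<longleftrightarrow> int v * int d dvd l * int u * int d"
    by (simp add: m n mult.assoc)
  also have "\<dots> \<longleftrightarrow> int v dvd l * int u" using d by simp
  also have "\<dots> \<longleftrightarrow> int v dvd l"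
    using \<open>coprime u v\<close> by (simp add: coprime_dvd_mult_left_iff coprime_commute)
  finally show ?thesis by (simp add: v_def)
qed

text \<open>Put u = m / gcd m n and v = n / gcd m n. The pair determines n, since u fixes the gcd
  and then v fixes n. Moreover u divides m and 1 \<le> v \<le> 2 u, so the left side is a partial
  sum of the nonnegative terms on the right.\<close>

lemma sum_gcd_cofactor_le:
  fixes g :: "nat \<Rightarrow> real"
  assumes K: "K \<subseteq> {2 ^ s..<2 ^ Suc s}" and m: "m \<in> K" and g: "\<And>j. 0 \<le> g j"
  shows "(\<Sum>n\<in>K. g (n div gcd m n)) \<le> (\<Sum>d\<in>{d. d dvd m}. \<Sum>j\<in>{1..2 * d}. g j)"
proof -
  define \<phi> where "\<phi> n = (m div gcd m n, n div gcd m n)" for n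
  have pos: "n > 0" if "n \<in> K" for n
    using K that by (metis atLeastLessThan_iff gr0I power_eq_0_iff subsetD le_zero_eq zero_neq_numeral)
  have "m > 0" using pos m .
  then have fin: "finite {d. d dvd m}" by simp
  have "inj_on \<phi> K"
  proof (rule inj_onI)
    fix n n' assume "\<phi> n = \<phi> n'"
    then have eq: "m div gcd m n = m div gcd m n'" "n div gcd m n = n' div gcd m n'"
      by (auto simp: \<phi>_def)
    have "gcd m n * (m div gcd m n) = m" by simp
    moreover have "gcd m n' * (m div gcd m n) = m" unfolding eq(1) by simp
    moreover have "m div gcd m n > 0" using \<open>m > 0\<close> by (simp add: div_greater_zero_iff gcd_le1_nat)
    ultimately have "gcd m n = gcd m n'" by (metis mult_right_cancel less_irrefl)
    then show "n = n'" using eq(2) by (metis dvd_div_mult_self gcd_dvd2)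
  qed
  moreover have "\<phi> ` K \<subseteq> Sigma {d. d dvd m} (\<lambda>d. {1..2 * d})"
  proof (rule image_subsetI)
    fix n assume n: "n \<in> K"
    define d u v where "d = gcd m n" and "u = m div gcd m n" and "v = n div gcd m n"
    have d: "d > 0" and mn: "m = u * d" "n = v * d"
      using \<open>m > 0\<close> by (auto simp: d_def u_def v_def)
    \<comment> \<open>Both numbers lie in the same dyadic block; this is where the upper end 2 d of
      the range in \<open>Gfun\<close> comes from.\<close>
    have "n \<le> 2 * m" using subsetD[OF K n] subsetD[OF K m] by simp
    then have "v * d \<le> (2 * u) * d" by (simp add: mn)
    then have "v \<le> 2 * u" using d by simp
    moreover have "v \<ge> 1" using pos[OF n] mn by (auto intro: Suc_leI gr0I)
    moreover have "u dvd m" by (simp add: mn)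
    ultimately show "\<phi> n \<in> Sigma {d. d dvd m} (\<lambda>d. {1..2 * d})"
      by (simp add: \<phi>_def u_def v_def)
  qed
  ultimately have "(\<Sum>n\<in>K. g (snd (\<phi> n))) \<le> (\<Sum>p\<in>Sigma {d. d dvd m} (\<lambda>d. {1..2 * d}). g (snd p))"
    using fin g by (subst sum.reindex[symmetric, unfolded comp_def, of \<phi> K "\<lambda>p. g (snd p)"])
      (auto intro!: sum_mono2)
  also have "\<dots> = (\<Sum>d\<in>{d. d dvd m}. \<Sum>j\<in>{1..2 * d}. g j)"
    using fin by (subst sum.Sigma) (auto simp: split_beta)
  finally show ?thesis by (simp add: \<phi>_def)
qed

section \<open>Fourier coefficients at multiples, and the functions \<open>gfun\<close> and
  \<open>hfun\<close>\<close>

lemma summable_gfun: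
  assumes f: "L2_torus f" and r: "r > 0"
  shows "summable (\<lambda>k. (cmod (fcoef f (int r * int (Suc k))))\<^sup>2)"
proof (rule summableI_nonneg_bounded)
  have inj: "inj_on (\<lambda>k. int r * int (Suc k)) A" for A
    using r by (auto simp: inj_on_def)
  show "(\<Sum>k<n. (cmod (fcoef f (int r * int (Suc k))))\<^sup>2) \<le> (LINT x|unit_interval. (f x)\<^sup>2)" for n
    using Bessel_inequality[OF f, of "(\<lambda>k. int r * int (Suc k)) ` {..<n}"]
    by (simp add: sum.reindex[OF inj] comp_def del: of_nat_Suc)
qed simp

lemma gfun_nonneg:
  assumes "L2_torus f" "r > 0"
  shows "0 \<le> gfun f r"
  unfolding gfun_def using summable_gfun[OF assms] by (rule suminf_nonneg) simp

text \<open>\<open>gfun\<close> runs over positive multiples; negative ones contribute the same by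
  conjugate symmetry, whence the factor 2, and the frequency 0 contributes nothing by the assumption
  on \<open>fcoef f 0\<close>.\<close>

lemma sum_fcoef_multiples_le:
  assumes f: "L2_torus f" and f0: "fcoef f 0 = 0" and v: "v > 0"
  shows "(\<Sum>l\<in>{l\<in>{- int N..int N}. int v dvd l}. (cmod (fcoef f l))\<^sup>2) \<le> 2 * gfun f v"
proof -
  let ?a = "\<lambda>l. (cmod (fcoef f l))\<^sup>2"
  define P where "P = (\<lambda>k. int v * int (Suc k)) ` {..<N}"
  define Q where "Q = (\<lambda>k. - (int v * int (Suc k))) ` {..<N}"
  have sub: "{l\<in>{- int N..int N}. int v dvd l} \<subseteq> insert 0 (P \<union> Q)"
  proof
    fix l assume "l \<in> {l\<in>{- int N..int N}. int v dvd l}"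
    then have "int v dvd l" and lN: "\<bar>l\<bar> \<le> int N" by auto
    then obtain j where l: "l = int v * j" by (auto elim: dvdE)
    have "\<bar>j\<bar> \<le> \<bar>l\<bar>" using v by (simp add: l abs_mult mult_le_cancel_right1)
    then have jN: "nat \<bar>j\<bar> \<le> N" using lN by linarith
    consider "j = 0" | "j > 0" | "j < 0" by linarith
    then show "l \<in> insert 0 (P \<union> Q)"
    proof cases
      case 1
      then show ?thesis by (simp add: l)
    next
      case 2
      then have "l \<in> P" using jN unfolding P_def l by (intro image_eqI[of _ _ "nat j - 1"]) auto
      then show ?thesis by simp
    next
      case 3
      then have "l \<in> Q" using jN unfolding Q_def l by (intro image_eqI[of _ _ "nat (- j) - 1"]) auto
      then show ?thesis by simp
    qed
  qed
  have le: "(\<Sum>k<N. ?a (int v * int (Suc k))) \<le> gfun f v"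
    unfolding gfun_def using summable_gfun[OF f v] by (intro sum_le_suminf) auto
  have P: "sum ?a P \<le> gfun f v"
    unfolding P_def using le by (subst sum.reindex) (use v in \<open>auto simp: inj_on_def\<close>)
  have "sum ?a Q = (\<Sum>k<N. ?a (- (int v * int (Suc k))))"
    unfolding Q_def by (subst sum.reindex) (use v in \<open>auto simp: inj_on_def\<close>)
  then have Q: "sum ?a Q \<le> gfun f v"
    using le by (simp only: fcoef_uminus complex_mod_cnj)
  have "(\<Sum>l\<in>{l\<in>{- int N..int N}. int v dvd l}. ?a l) \<le> sum ?a (insert 0 (P \<union> Q))"
    using sub by (intro sum_mono2) (auto simp: P_def Q_def)
  also have "\<dots> = sum ?a (P \<union> Q)"
    by (rule sum.mono_neutral_right) (auto simp: f0 P_def Q_def)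
  also have "\<dots> \<le> sum ?a P + sum ?a Q"
    by (subst sum.union_inter[symmetric]) (auto simp: P_def Q_def sum_nonneg)
  finally show ?thesis using P Q by simp
qed

lemma Gfun_le_hfun:
  assumes f: "L2_torus f" and n: "n > 0"
  shows "(\<Sum>d\<in>{d. d dvd n}. Gfun f d) \<le> hfun f n" "0 \<le> hfun f n"
proof -
  have pos: "d > 0" if "d dvd n" for d using that n by (auto intro: gr0I)
  have G: "0 \<le> Gfun f d" for d
    unfolding Gfun_def using gfun_nonneg[OF f] by (intro sum_nonneg) auto
  show le: "(\<Sum>d\<in>{d. d dvd n}. Gfun f d) \<le> hfun f n"
    unfolding hfun_def using gfun_nonneg[OF f] pos by (intro sum_mono) auto
  show "0 \<le> hfun f n"
    using G by (intro order_trans[OF sum_nonneg le]) auto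
qed

text \<open>The dilated polynomial is an exponential sum over pairs (k, l) with frequency l k, so
  \<open>nn_integral_exponential_sum_le\<close> reduces the claim to counting coinciding
  frequencies, and this count is organised by gcd cofactors.\<close>

lemma nn_integral_dilated_trig_le:
  fixes c :: "nat \<Rightarrow> real"
  assumes f: "L2_torus f" and f0: "fcoef f 0 = 0" and K: "K \<subseteq> {2 ^ s..<2 ^ Suc s}"
  shows "(\<integral>\<^sup>+x. ennreal ((cmod (\<Sum>k\<in>K. c k * (\<Sum>l\<in>{- int N..int N}. fcoef f l * fchar l (real k * x))))\<^sup>2)
      \<partial>unit_interval) \<le> ennreal (\<Sum>k\<in>K. 2 * ((c k)\<^sup>2 * hfun f k))"
proof -
  have finK: "finite K" using K finite_subset by blast
  have pos: "n > 0" if "n \<in> K" for n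
    using K that by (metis atLeastLessThan_iff gr0I power_eq_0_iff subsetD le_zero_eq zero_neq_numeral)
  let ?L = "{- int N..int N}"
  let ?\<nu> = "\<lambda>i :: nat \<times> int. snd i * int (fst i)"
  let ?b = "\<lambda>i. complex_of_real (c (fst i)) * fcoef f (snd i)"
  have dil: "fchar l (real k * x) = fchar (l * int k) x" for l k x
    using fchar_scale[of l "int k" x] by (simp add: mult.commute)
  have eq: "(\<Sum>k\<in>K. c k * (\<Sum>l\<in>?L. fcoef f l * fchar l (real k * x)))
      = (\<Sum>i\<in>K \<times> ?L. ?b i * fchar (?\<nu> i) x)" for x
    by (simp add: sum_distrib_left sum.cartesian_product split_beta dil mult.assoc)
  have "(\<Sum>i\<in>K \<times> ?L. (cmod (?b i))\<^sup>2 * real (card {j \<in> K \<times> ?L. ?\<nu> j = ?\<nu> i}))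
      \<le> (\<Sum>i\<in>K \<times> ?L. (cmod (?b i))\<^sup>2 * (\<Sum>n\<in>K. if int n dvd ?\<nu> i then 1 else 0))"
  proof (intro sum_mono mult_left_mono)
    fix i
    \<comment> \<open>Within one frequency class the dilation factor n > 0 determines l, so it
      suffices to count the n in K dividing the common frequency.\<close>
    have "card {j \<in> K \<times> ?L. ?\<nu> j = ?\<nu> i} \<le> card {n\<in>K. int n dvd ?\<nu> i}"
    proof (rule card_inj_on_le)
      show "inj_on fst {j \<in> K \<times> ?L. ?\<nu> j = ?\<nu> i}"
      proof (rule inj_onI)
        fix p q assume p: "p \<in> {j \<in> K \<times> ?L. ?\<nu> j = ?\<nu> i}" and q: "q \<in> {j \<in> K \<times> ?L. ?\<nu> j = ?\<nu> i}"
          and eq: "fst p = fst q"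
        then have "fst p > 0" "snd p * int (fst p) = snd q * int (fst p)"
          using pos by auto
        then show "p = q" using eq by (intro prod_eqI) auto
      qed
      show "fst ` {j \<in> K \<times> ?L. ?\<nu> j = ?\<nu> i} \<subseteq> {n\<in>K. int n dvd ?\<nu> i}"
        by (auto simp flip: dvd_triv_right) (metis dvd_triv_right)
    qed (use finK in simp)
    then show "real (card {j \<in> K \<times> ?L. ?\<nu> j = ?\<nu> i}) \<le> (\<Sum>n\<in>K. if int n dvd ?\<nu> i then 1 else 0)"
      using finK by (simp add: sum.inter_filter[symmetric])
  qed simp
  \<comment> \<open>Divisibility of l m by n is rewritten through the cofactor of n, and the sums
    over l and n are exchanged, so that for fixed m and n a sum of squared coefficients over
    multiples appears.\<close>
  also have "\<dots> = (\<Sum>m\<in>K. (c m)\<^sup>2 * (\<Sum>n\<in>K. \<Sum>l\<in>{l\<in>?L. int (n div gcd m n) dvd l}. (cmod (fcoef f l))\<^sup>2))"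
  proof -
    have "(\<Sum>l\<in>?L. (cmod (?b (m, l)))\<^sup>2 * (\<Sum>n\<in>K. if int n dvd ?\<nu> (m, l) then 1 else 0))
      = (c m)\<^sup>2 * (\<Sum>n\<in>K. \<Sum>l\<in>{l\<in>?L. int (n div gcd m n) dvd l}. (cmod (fcoef f l))\<^sup>2)" if "m \<in> K" for m
    proof -
      have "(\<Sum>l\<in>?L. (cmod (?b (m, l)))\<^sup>2 * (\<Sum>n\<in>K. if int n dvd ?\<nu> (m, l) then 1 else 0))
        = (c m)\<^sup>2 * (\<Sum>l\<in>?L. \<Sum>n\<in>K. if int (n div gcd m n) dvd l then (cmod (fcoef f l))\<^sup>2 else 0)"
        unfolding sum_distrib_left
        by (intro sum.cong refl)
           (simp add: gcd_cofactor_dvd_iff[OF pos[OF that]] norm_mult power_mult_distrib)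
      also have "(\<Sum>l\<in>?L. \<Sum>n\<in>K. if int (n div gcd m n) dvd l then (cmod (fcoef f l))\<^sup>2 else 0)
        = (\<Sum>n\<in>K. \<Sum>l\<in>{l\<in>?L. int (n div gcd m n) dvd l}. (cmod (fcoef f l))\<^sup>2)"
        by (subst sum.swap) (intro sum.cong refl sum.inter_filter[symmetric], simp)
      finally show ?thesis .
    qed
    then show ?thesis
      unfolding sum.cartesian_product' by (intro sum.cong refl)
  qed
  also have "\<dots> \<le> (\<Sum>m\<in>K. (c m)\<^sup>2 * (2 * hfun f m))"
  proof (intro sum_mono mult_left_mono)
    fix m assume m: "m \<in> K"
    have cof: "n div gcd m n > 0" if "n \<in> K" for n
      using pos[OF that] by (simp add: div_greater_zero_iff gcd_le2_nat)
    \<comment> \<open>Truncation by \<open>max 0\<close> supplies nonnegativity at every argument,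
      as \<open>sum_gcd_cofactor_le\<close> demands; at positive arguments it changes
      nothing.\<close>
    have "(\<Sum>n\<in>K. \<Sum>l\<in>{l\<in>?L. int (n div gcd m n) dvd l}. (cmod (fcoef f l))\<^sup>2)
      \<le> (\<Sum>n\<in>K. 2 * max 0 (gfun f (n div gcd m n)))"
      by (intro sum_mono order_trans[OF sum_fcoef_multiples_le[OF f f0 cof]]) auto
    also have "\<dots> = 2 * (\<Sum>n\<in>K. max 0 (gfun f (n div gcd m n)))"
      by (simp add: sum_distrib_left)
    also have "(\<Sum>n\<in>K. max 0 (gfun f (n div gcd m n)))
      \<le> (\<Sum>d\<in>{d. d dvd m}. \<Sum>j\<in>{1..2 * d}. max 0 (gfun f j))"
      by (rule sum_gcd_cofactor_le[OF K m, of "\<lambda>j. max 0 (gfun f j)"]) simp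
    also have "\<dots> = (\<Sum>d\<in>{d. d dvd m}. Gfun f d)"
      unfolding Gfun_def using gfun_nonneg[OF f] by (intro sum.cong refl) auto
    also have "\<dots> \<le> hfun f m" by (rule Gfun_le_hfun(1)[OF f pos[OF m]])
    finally show "(\<Sum>n\<in>K. \<Sum>l\<in>{l\<in>?L. int (n div gcd m n) dvd l}. (cmod (fcoef f l))\<^sup>2) \<le> 2 * hfun f m"
      by simp
  qed simp
  finally have "(\<Sum>i\<in>K \<times> ?L. (cmod (?b i))\<^sup>2 * real (card {j \<in> K \<times> ?L. ?\<nu> j = ?\<nu> i}))
      \<le> (\<Sum>k\<in>K. 2 * ((c k)\<^sup>2 * hfun f k))" by (simp add: mult_ac)
  moreover have "(\<integral>\<^sup>+x. ennreal ((cmod (\<Sum>i\<in>K \<times> ?L. ?b i * fchar (?\<nu> i) x))\<^sup>2) \<partial>unit_interval)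
      \<le> ennreal (\<Sum>i\<in>K \<times> ?L. (cmod (?b i))\<^sup>2 * real (card {j \<in> K \<times> ?L. ?\<nu> j = ?\<nu> i}))"
    using finK by (intro nn_integral_exponential_sum_le) simp
  ultimately show ?thesis
    unfolding eq by (meson ennreal_leI order_trans)
qed

lemma fchar_periodic: "fchar l (x + 1) = fchar l x"
proof -
  have "fchar l (x + 1) = fchar l x * fchar l (of_int 1)"
    by (simp add: fchar_def exp_add[symmetric] distrib_left)
  then show ?thesis by (simp only: fchar_of_int mult_1_right)
qed

text \<open>Passage from Fourier partial sums to f: splitting f into p and f - p doubles the
  constant 2 of the polynomial bound to 4, and the contribution of f - p is made smaller than any e
  because dilation preserves its square norm.\<close>

lemma nn_integral_dilated_sum_le:
  fixes c :: "nat \<Rightarrow> real"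
  assumes f: "L2_torus f" and f0: "fcoef f 0 = 0" and K: "K \<subseteq> {2 ^ s..<2 ^ Suc s}"
  shows "(\<integral>\<^sup>+x. ennreal ((\<Sum>k\<in>K. c k * f (real k * x))\<^sup>2) \<partial>unit_interval)
    \<le> ennreal (\<Sum>k\<in>K. 4 * ((c k)\<^sup>2 * hfun f k))"
proof (rule ennreal_le_epsilon)
  fix e :: real assume "e > 0"
  have finK: "finite K" using K finite_subset by blast
  have pos: "n > 0" if "n \<in> K" for n
    using K that by (metis atLeastLessThan_iff gr0I power_eq_0_iff subsetD le_zero_eq zero_neq_numeral)
  have [measurable]: "f \<in> borel_measurable borel" by (rule integrable_L2_torus(1)[OF f])
  have per: "f (x + 1) = f x" for x using f by (simp add: L2_torus_def)
  define C where "C = (\<Sum>k\<in>K. (c k)\<^sup>2)"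
  have C: "C \<ge> 0" by (simp add: C_def sum_nonneg)
  \<comment> \<open>Chosen so that the total error 2 C |K| \<delta> stays below e; the summand 1
    keeps the denominator positive when C or the cardinality is zero.\<close>
  define \<delta> where "\<delta> = e / (2 * C * card K + 1)"
  have den: "2 * C * card K + 1 > 0" using C by (intro add_nonneg_pos) auto
  then have \<delta>: "\<delta> > 0" "2 * C * card K * \<delta> \<le> e"
    using \<open>e > 0\<close> by (auto simp: \<delta>_def field_simps)
  obtain N where N: "(\<integral>\<^sup>+x. ennreal ((cmod (f x - (\<Sum>l\<in>{- int N..int N}. fcoef f l * fchar l x)))\<^sup>2)
      \<partial>unit_interval) < ennreal \<delta>"
    using fourier_partial_sum_converges[OF f \<delta>(1)] by blast
  define p where "p x = (\<Sum>l\<in>{- int N..int N}. fcoef f l * fchar l x)" for x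
  have [measurable]: "p \<in> borel_measurable borel" unfolding p_def by measurable
  have p_per: "p (x + 1) = p x" for x by (simp add: p_def fchar_periodic)
  define r where "r x = (cmod (f x - p x))\<^sup>2" for x
  have [measurable]: "r \<in> borel_measurable borel" unfolding r_def by measurable
  have r: "(\<integral>\<^sup>+x. ennreal (r (real k * x)) \<partial>unit_interval) \<le> ennreal \<delta>" if "k \<in> K" for k
    using nn_integral_dilate[of "\<lambda>x. ennreal (r x)" k] N pos[OF that]
    by (simp add: r_def per p_per p_def[symmetric] less_imp_le)
  have pointwise: "(\<Sum>k\<in>K. c k * f (real k * x))\<^sup>2
      \<le> 2 * (cmod (\<Sum>k\<in>K. c k * p (real k * x)))\<^sup>2 + 2 * C * (\<Sum>k\<in>K. r (real k * x))" for x
  proof -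
    define w where "w k = complex_of_real (f (real k * x)) - p (real k * x)" for k
    have "complex_of_real (\<Sum>k\<in>K. c k * f (real k * x))
        = (\<Sum>k\<in>K. c k * p (real k * x)) + (\<Sum>k\<in>K. c k * w k)"
      by (simp add: w_def sum.distrib[symmetric] algebra_simps)
    then have "(\<Sum>k\<in>K. c k * f (real k * x))\<^sup>2
        = (cmod ((\<Sum>k\<in>K. c k * p (real k * x)) + (\<Sum>k\<in>K. c k * w k)))\<^sup>2"
      by (metis norm_of_real power2_abs)
    also have "\<dots> \<le> 2 * (cmod (\<Sum>k\<in>K. c k * p (real k * x)))\<^sup>2 + 2 * (cmod (\<Sum>k\<in>K. c k * w k))\<^sup>2"
      by (rule norm_add_square_le)
    also have "(cmod (\<Sum>k\<in>K. c k * w k))\<^sup>2 \<le> (\<Sum>k\<in>K. \<bar>c k\<bar> * cmod (w k))\<^sup>2"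
      by (intro power_mono order_trans[OF norm_sum]) (simp_all add: norm_mult)
    also have "\<dots> \<le> (\<Sum>k\<in>K. \<bar>c k\<bar>\<^sup>2) * (\<Sum>k\<in>K. (cmod (w k))\<^sup>2)"
      by (rule Cauchy_Schwarz_ineq_sum)
    finally show ?thesis by (simp add: C_def r_def w_def)
  qed
  let ?S = "\<Sum>k\<in>K. 2 * ((c k)\<^sup>2 * hfun f k)"
  have S: "?S \<ge> 0"
    using Gfun_le_hfun(2)[OF f pos] by (intro sum_nonneg) auto
  have "(\<integral>\<^sup>+x. ennreal ((\<Sum>k\<in>K. c k * f (real k * x))\<^sup>2) \<partial>unit_interval)
    \<le> (\<integral>\<^sup>+x. ennreal 2 * ennreal ((cmod (\<Sum>k\<in>K. c k * p (real k * x)))\<^sup>2)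
        + ennreal (2 * C) * (\<Sum>k\<in>K. ennreal (r (real k * x))) \<partial>unit_interval)"
  proof (rule nn_integral_mono)
    fix x
    have r0: "r y \<ge> 0" for y by (simp add: r_def)
    have "ennreal ((\<Sum>k\<in>K. c k * f (real k * x))\<^sup>2)
      \<le> ennreal (2 * (cmod (\<Sum>k\<in>K. c k * p (real k * x)))\<^sup>2 + 2 * C * (\<Sum>k\<in>K. r (real k * x)))"
      by (rule ennreal_leI[OF pointwise])
    also have "\<dots> = ennreal 2 * ennreal ((cmod (\<Sum>k\<in>K. c k * p (real k * x)))\<^sup>2)
        + ennreal (2 * C) * ennreal (\<Sum>k\<in>K. r (real k * x))"
      using C r0 by (simp only: ennreal_plus ennreal_mult sum_nonneg zero_le_power2 mult_nonneg_nonneg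
          zero_le_numeral)
    also have "ennreal (\<Sum>k\<in>K. r (real k * x)) = (\<Sum>k\<in>K. ennreal (r (real k * x)))"
      using r0 by (intro sum_ennreal[symmetric])
    finally show "ennreal ((\<Sum>k\<in>K. c k * f (real k * x))\<^sup>2)
      \<le> ennreal 2 * ennreal ((cmod (\<Sum>k\<in>K. c k * p (real k * x)))\<^sup>2)
        + ennreal (2 * C) * (\<Sum>k\<in>K. ennreal (r (real k * x)))" .
  qed
  also have "\<dots> = ennreal 2 * (\<integral>\<^sup>+x. ennreal ((cmod (\<Sum>k\<in>K. c k * p (real k * x)))\<^sup>2) \<partial>unit_interval)
      + ennreal (2 * C) * (\<Sum>k\<in>K. \<integral>\<^sup>+x. ennreal (r (real k * x)) \<partial>unit_interval)"
    by (subst nn_integral_add, measurable) (simp add: nn_integral_cmult nn_integral_sum del: ennreal_numeral)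
  also have "\<dots> \<le> ennreal 2 * ennreal ?S + ennreal (2 * C) * (\<Sum>k\<in>K. ennreal \<delta>)"
    using nn_integral_dilated_trig_le[OF f f0 K, of c N] r
    by (intro add_mono mult_left_mono sum_mono) (simp_all add: p_def)
  also have "\<dots> = ennreal (2 * ?S + 2 * C * card K * \<delta>)"
    using S C \<delta>(1)
    by (simp add: ennreal_plus ennreal_mult ennreal_of_nat_eq_real_of_nat mult.assoc del: ennreal_numeral)
  also have "\<dots> \<le> ennreal (2 * ?S + e)" using \<delta>(2) by (intro ennreal_leI) simp
  also have "\<dots> = ennreal (2 * ?S) + ennreal e" using S \<open>e > 0\<close> by (intro ennreal_plus) auto
  also have "2 * ?S = (\<Sum>k\<in>K. 4 * ((c k)\<^sup>2 * hfun f k))"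
    by (simp add: sum_distrib_left)
  finally show "(\<integral>\<^sup>+x. ennreal ((\<Sum>k\<in>K. c k * f (real k * x))\<^sup>2) \<partial>unit_interval)
    \<le> ennreal (\<Sum>k\<in>K. 4 * ((c k)\<^sup>2 * hfun f k)) + ennreal e" .
qed

lemma AE_summable_dilated_series:
  fixes f :: "real \<Rightarrow> real" and c :: "nat \<Rightarrow> real"
  assumes f: "L2_torus f" and mean: "(LINT x:{0..1}|lborel. f x) = 0"
    and sm: "summable (\<lambda>k. (c (Suc k))\<^sup>2 * hfun f (Suc k) * (ln (real (Suc k)))\<^sup>2)"
  shows "AE x in lborel. x \<in> {0..1} \<longrightarrow> summable (\<lambda>k. c (Suc k) * f (real (Suc k) * x))"
proof -
  have [measurable]: "f \<in> borel_measurable borel" by (rule integrable_L2_torus(1)[OF f])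
  have "fcoef f 0 = (LINT x|unit_interval. complex_of_real (f x))" by (simp add: fcoef_eq)
  also have "\<dots> = complex_of_real (LINT x:{0..1}|lborel. f x)"
    by (simp add: set_lebesgue_integral_def integral_restrict_space)
  finally have f0: "fcoef f 0 = 0" by (simp add: mean)
  \<comment> \<open>Index 0 belongs to no dyadic block; setting \<open>w 0\<close> to 0 makes the
    weight nonnegative at the one index outside the range n > 0 of
    \<open>Gfun_le_hfun\<close>.\<close>
  define w where "w k = (if k = 0 then 0 else 4 * ((c k)\<^sup>2 * hfun f k))" for k
  have "AE x in unit_interval. summable (\<lambda>k. c k * f (real k * x))"
  proof (rule AE_summable_quasi_orthogonal)
    show "0 \<le> w k" for k using Gfun_le_hfun(2)[OF f] by (simp add: w_def)
    show "(\<integral>\<^sup>+x. ennreal ((\<Sum>k\<in>{i..<j}. c k * f (real k * x))\<^sup>2) \<partial>unit_interval)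
        \<le> ennreal (\<Sum>k\<in>{i..<j}. w k)" if ij: "2 ^ s \<le> i" "i \<le> j" "j \<le> 2 ^ Suc s" for s i j
    proof -
      have "i > 0" using ij(1) by (metis gr0I le_zero_eq power_eq_0_iff zero_neq_numeral)
      then have "(\<Sum>k\<in>{i..<j}. w k) = (\<Sum>k\<in>{i..<j}. 4 * ((c k)\<^sup>2 * hfun f k))"
        by (intro sum.cong) (auto simp: w_def)
      then show ?thesis using nn_integral_dilated_sum_le[OF f f0, of "{i..<j}" s c] ij by simp
    qed
    have "summable (\<lambda>k. w (Suc k) * (ln (real (Suc k)))\<^sup>2)"
      using summable_mult[OF sm, of 4] by (simp add: w_def mult.assoc del: of_nat_Suc)
    then show "summable (\<lambda>k. w k * (ln (real k))\<^sup>2)"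
      by (subst (asm) summable_Suc_iff[of "\<lambda>k. w k * (ln (real k))\<^sup>2"])
  qed measurable
  then have "AE x in unit_interval. summable (\<lambda>k. c (Suc k) * f (real (Suc k) * x))"
    by eventually_elim (subst summable_Suc_iff[of "\<lambda>k. c k * f (real k * x)" for x])
  then show ?thesis by (subst (asm) AE_restrict_space_iff) auto
qed

section \<open>Divergence along sparse primes\<close>

lemma fcoef_cos:
  "fcoef (\<lambda>x. cos (2 * pi * x)) l = (if \<bar>l\<bar> = 1 then 1 / 2 else 0)"
proof -
  have e: "complex_of_real (cos (2 * pi * x)) * fchar (- l) x
      = (1 / 2) * (fchar (1 - l) x + fchar (- 1 - l) x)" for x
    unfolding cos_of_real[symmetric] cos_exp_eq fchar_def
    by (simp add: exp_add[symmetric] algebra_simps add_divide_distrib)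
  have int: "integrable unit_interval (fchar k)" for k
    by (rule integrable_unit_interval_bounded[where B = 1]) auto
  have "fcoef (\<lambda>x. cos (2 * pi * x)) l
      = (1 / 2) * ((LINT x|unit_interval. fchar (1 - l) x) + (LINT x|unit_interval. fchar (- 1 - l) x))"
    unfolding fcoef_eq e integral_mult_right_zero
    by (simp add: Bochner_Integration.integral_add[OF int int])
  then show ?thesis by (auto simp: integral_fchar)
qed

lemma gfun_cos:
  assumes "r > 0"
  shows "gfun (\<lambda>x. cos (2 * pi * x)) r = (if r = 1 then 1 / 4 else 0)"
proof -
  have "gfun (\<lambda>x. cos (2 * pi * x)) r = (\<Sum>k. if k = 0 then if r = 1 then 1 / 4 else 0 else 0)"
    unfolding gfun_def fcoef_cos
  proof (intro suminf_cong)
    fix k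
    have "\<bar>int r * int (Suc k)\<bar> = 1 \<longleftrightarrow> r = 1 \<and> k = 0"
      by (metis abs_of_nat mult_eq_1_iff of_nat_eq_1_iff of_nat_mult One_nat_def Suc_inject)
    then show "(cmod (if \<bar>int r * int (Suc k)\<bar> = 1 then 1 / 2 else 0))\<^sup>2
        = (if k = 0 then if r = 1 then 1 / 4 else 0 else 0)"
      by (auto simp: power2_eq_square norm_divide)
  qed
  also have "\<dots> = (if r = 1 then 1 / 4 else 0)"
    by (subst suminf_finite[of "{0}"]) auto
  finally show ?thesis .
qed

text \<open>The divisor 1 contributes 1/4 + 1/4, the divisor p contributes 0 + 1/4.\<close>

lemma hfun_cos_prime:
  assumes "prime p"
  shows "hfun (\<lambda>x. cos (2 * pi * x)) p = 3 / 4"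
proof -
  have G: "Gfun (\<lambda>x. cos (2 * pi * x)) r = 1 / 4" if "r > 0" for r
  proof -
    have "Gfun (\<lambda>x. cos (2 * pi * x)) r = (\<Sum>j\<in>{1..2 * r}. if j = 1 then 1 / 4 else 0)"
      unfolding Gfun_def by (intro sum.cong refl gfun_cos) auto
    with that show ?thesis by simp
  qed
  have "{d. d dvd p} = {1, p}" "p \<noteq> 1" "p > 0"
    using assms by (auto simp: prime_nat_iff)
  then show ?thesis by (simp add: hfun_def G gfun_cos)
qed

text \<open>Recursive choice: each new prime exceeds the sum of the previous one and the prescribed
  bound, which gives monotonicity and growth together.\<close>

lemma sparse_primes:
  fixes B :: "nat \<Rightarrow> nat"
  obtains P :: "nat \<Rightarrow> nat" where "strict_mono P" "\<And>m. prime (P m)" "\<And>m. B m \<le> P m"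
proof -
  have ex: "\<exists>p. prime p \<and> n < p" for n :: nat
    using bigger_prime by blast
  define P where "P = rec_nat (SOME p. prime p \<and> B 0 < p) (\<lambda>m q. SOME p. prime p \<and> q + B (Suc m) < p)"
  have P0: "prime (P 0) \<and> B 0 < P 0"
    unfolding P_def by (simp, rule someI_ex[OF ex])
  have PS: "prime (P (Suc m)) \<and> P m + B (Suc m) < P (Suc m)" for m
    unfolding P_def by (simp, rule someI_ex[OF ex])
  have "strict_mono P" using PS by (auto simp: strict_mono_Suc_iff intro: add_lessD1)
  moreover have P: "prime (P m) \<and> B m \<le> P m" for m
  proof (cases m)
    case 0
    with P0 show ?thesis by simp
  next
    case (Suc n)
    with PS[of n] show ?thesis by simp
  qed
  ultimately show ?thesis using that by blast
qed

text \<open>Convergence would force \<open>cos\<^sup>2 (2 \<pi> P_m x) \<rightarrow> 0\<close> almost everywhere, but these functions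
  all have mean \<open>1/2\<close>.\<close>
lemma not_AE_summable_cos:
  fixes P :: "nat \<Rightarrow> nat" and c :: "nat \<Rightarrow> real"
  assumes P: "strict_mono P" "\<And>m. P m > 0" and c: "\<And>m. c (P m) = 1"
  shows "\<not> (AE x in lborel. x \<in> {0..1} \<longrightarrow>
    summable (\<lambda>k. c (Suc k) * cos (2 * pi * (real (Suc k) * x))))"
proof
  assume "AE x in lborel. x \<in> {0..1} \<longrightarrow>
    summable (\<lambda>k. c (Suc k) * cos (2 * pi * (real (Suc k) * x)))"
  then have "AE x in unit_interval. summable (\<lambda>k. c (Suc k) * cos (2 * pi * (real (Suc k) * x)))"
    by (subst AE_restrict_space_iff) auto
  then have lim: "AE x in unit_interval. (\<lambda>m. (cos (2 * pi * (real (P m) * x)))\<^sup>2) \<longlonglongrightarrow> 0"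
  proof eventually_elim
    case (elim x)
    have "(\<lambda>k. c (Suc k) * cos (2 * pi * (real (Suc k) * x))) \<longlonglongrightarrow> 0"
      by (rule summable_LIMSEQ_zero[OF elim])
    then have "(\<lambda>k. c k * cos (2 * pi * (real k * x))) \<longlonglongrightarrow> 0"
      by (rule LIMSEQ_imp_Suc)
    from LIMSEQ_subseq_LIMSEQ[OF this P(1)]
    have "(\<lambda>m. cos (2 * pi * (real (P m) * x))) \<longlonglongrightarrow> 0"
      by (simp add: comp_def c)
    then have "(\<lambda>m. (cos (2 * pi * (real (P m) * x)))\<^sup>2) \<longlonglongrightarrow> 0\<^sup>2"
      by (rule tendsto_power)
    then show ?case by simp
  qed
  have [measurable]: "(\<lambda>x. (cos (2 * pi * (real n * x)))\<^sup>2) \<in> borel_measurable borel" for n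
    by (intro borel_measurable_continuous_onI continuous_intros)
  have "(\<lambda>m. LINT x|unit_interval. (cos (2 * pi * (real (P m) * x)))\<^sup>2) \<longlonglongrightarrow> (LINT x|unit_interval. 0)"
  proof (rule integral_dominated_convergence[OF _ _ _ lim])
    show "integrable unit_interval (\<lambda>_. 1 :: real)"
      by (rule integrable_unit_interval_bounded[where B = 1]) auto
    show "AE x in unit_interval. norm ((cos (2 * pi * (real (P m) * x)))\<^sup>2) \<le> 1" for m
      by (simp add: abs_square_le_1)
  qed auto
  moreover have "(LINT x|unit_interval. (cos (2 * pi * (real n * x)))\<^sup>2) = 1 / 2" if "n > 0" for n :: nat
  proof -
    \<comment> \<open>The squared cosine in characters: for n > 0 only the constant term 2/4
      survives integration.\<close>
    have e: "complex_of_real ((cos (2 * pi * (real n * x)))\<^sup>2)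
        = 1 / 4 * (fchar 0 x * 2 + (fchar (2 * int n) x + fchar (- 2 * int n) x))" for x
      unfolding of_real_power cos_of_real[symmetric] cos_exp_eq fchar_def
      by (simp add: power2_eq_square exp_add[symmetric] algebra_simps add_divide_distrib)
    have int: "integrable unit_interval (fchar k)" for k
      by (rule integrable_unit_interval_bounded[where B = 1]) auto
    have "complex_of_real (LINT x|unit_interval. (cos (2 * pi * (real n * x)))\<^sup>2)
        = 1 / 4 * ((LINT x|unit_interval. fchar 0 x) * 2 +
           ((LINT x|unit_interval. fchar (2 * int n) x) + (LINT x|unit_interval. fchar (- 2 * int n) x)))"
      unfolding integral_complex_of_real[symmetric] e integral_mult_right_zero
      by (simp only: Bochner_Integration.integral_add Bochner_Integration.integrable_add
          integrable_mult_left integral_mult_left_zero int)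
    also have "\<dots> = complex_of_real (1 / 2)" using that by (simp only: integral_fchar) simp
    finally show ?thesis by (simp only: of_real_eq_iff)
  qed
  ultimately have "(\<lambda>m::nat. 1 / 2 :: real) \<longlonglongrightarrow> 0" using P(2) by simp
  then show False by (simp add: LIMSEQ_const_iff)
qed

lemma L2_torus_cos: "L2_torus (\<lambda>x. cos (2 * pi * x))"
proof -
  have [measurable]: "(\<lambda>x. cos (2 * pi * x)) \<in> borel_measurable borel"
    by (intro borel_measurable_continuous_onI continuous_intros)
  have "integrable unit_interval (\<lambda>x. (cos (2 * pi * x))\<^sup>2)"
    by (rule integrable_unit_interval_bounded[where B = 1]) (auto simp: abs_square_le_1)
  then show ?thesis
    using cos_periodic[of "2 * pi * x" for x]
    by (simp add: L2_torus_def set_integrable_def integrable_restrict_space distrib_left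
        del: cos_periodic)
qed

lemma dilated_series_counterexample:
  fixes \<delta> :: real
  assumes "\<delta> > 0"
  shows "\<exists>(f :: real \<Rightarrow> real) (c :: nat \<Rightarrow> real).
     L2_torus f \<and> (LINT x:{0..1}|lborel. f x) = 0 \<and>
     summable (\<lambda>k. (c (Suc k))\<^sup>2 * hfun f (Suc k) * ln (real (Suc k)) powr (- \<delta>)) \<and>
     \<not> (AE x in lborel. x \<in> {0..1} \<longrightarrow> summable (\<lambda>k. c (Suc k) * f (real (Suc k) * x)))"
proof -
  define f where "f x = cos (2 * pi * x)" for x :: real
  have f: "f = (\<lambda>x. cos (2 * pi * x))" by (simp add: f_def fun_eq_iff)
  \<comment> \<open>A prime of at least this size has logarithm at least 2^(m / \<delta>), so its
    logarithm to the power -\<delta> is at most 2^(-m), which is summable.\<close>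
  define B where "B m = nat \<lceil>exp ((2 ^ m) powr (1 / \<delta>) :: real)\<rceil>" for m :: nat
  obtain P where P: "strict_mono P" "\<And>m. prime (P m)" "\<And>m. B m \<le> P m"
    using sparse_primes by blast
  have P0: "P m > 0" for m using P(2) prime_gt_0_nat by blast
  define c :: "nat \<Rightarrow> real" where "c k = (if k \<in> range P then 1 else 0)" for k
  define t where "t k = (c k)\<^sup>2 * hfun f k * ln (real k) powr (- \<delta>)" for k
  have "complex_of_real (LINT x:{0..1}|lborel. f x) = fcoef f 0"
    by (simp add: fcoef_eq set_lebesgue_integral_def integral_restrict_space)
  then have mean: "(LINT x:{0..1}|lborel. f x) = 0"
    using fcoef_cos[of 0] f by simp
  have tP: "norm (t (P m)) \<le> 3 / 4 * (1 / 2) ^ m" for m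
  proof -
    have "exp ((2 ^ m) powr (1 / \<delta>)) \<le> real (P m)"
      using P(3)[of m] unfolding B_def by linarith
    then have "(2 ^ m) powr (1 / \<delta>) \<le> ln (real (P m))"
      using P0[of m] by (subst ln_ge_iff) auto
    then have "ln (real (P m)) powr (- \<delta>) \<le> ((2 ^ m) powr (1 / \<delta>)) powr (- \<delta>)"
      using assms by (intro powr_mono2') auto
    also have "((2 ^ m) powr (1 / \<delta>)) powr (- \<delta>) = (1 / 2 :: real) ^ m"
      using assms by (simp add: powr_powr powr_minus power_divide field_simps)
    finally have "ln (real (P m)) powr (- \<delta>) \<le> (1 / 2) ^ m" .
    moreover have h: "hfun f (P m) = 3 / 4"
      unfolding f by (rule hfun_cos_prime[OF P(2)])
    ultimately show ?thesis unfolding t_def h by (simp add: c_def abs_mult)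
  qed
  have "summable (\<lambda>m. t (P m))"
    by (rule summable_comparison_test[of _ "\<lambda>m. 3 / 4 * (1 / 2) ^ m"])
       (use tP in \<open>auto intro!: summable_mult summable_geometric\<close>)
  \<comment> \<open>The terms vanish off the range of \<open>P\<close>, so summability along the
    strictly increasing \<open>P\<close> is summability of the whole series.\<close>
  then have "summable t"
    using P(1) by (subst (asm) summable_mono_reindex) (auto simp: t_def c_def)
  then have "summable (\<lambda>k. t (Suc k))" by (subst summable_Suc_iff)
  moreover have "\<not> (AE x in lborel. x \<in> {0..1} \<longrightarrow>
      summable (\<lambda>k. c (Suc k) * f (real (Suc k) * x)))"
    unfolding f_def by (rule not_AE_summable_cos[OF P(1) P0]) (simp add: c_def)
  moreover have "L2_torus f" unfolding f_def by (rule L2_torus_cos)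
  ultimately show ?thesis using mean unfolding t_def by blast
qed

theorem theorem2:
  shows "(\<forall>(f :: real \<Rightarrow> real) (c :: nat \<Rightarrow> real).
            L2_torus f \<longrightarrow> (LINT x:{0..1}|lborel. f x) = 0 \<longrightarrow>
            summable (\<lambda>k. (c (Suc k))\<^sup>2 * hfun f (Suc k) * (ln (real (Suc k)))\<^sup>2) \<longrightarrow>
            (AE x in lborel. x \<in> {0..1} \<longrightarrow>
               summable (\<lambda>k. c (Suc k) * f (real (Suc k) * x))))
       \<and> (\<forall>\<delta>::real. \<delta> > 0 \<longrightarrow>
            (\<exists>(f :: real \<Rightarrow> real) (c :: nat \<Rightarrow> real).
               L2_torus f \<and> (LINT x:{0..1}|lborel. f x) = 0 \<and>
               summable (\<lambda>k. (c (Suc k))\<^sup>2 * hfun f (Suc k) * ln (real (Suc k)) powr (- \<delta>)) \<and>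
               \<not> (AE x in lborel. x \<in> {0..1} \<longrightarrow>
                    summable (\<lambda>k. c (Suc k) * f (real (Suc k) * x)))))"
proof (intro conjI allI impI)
  fix f :: "real \<Rightarrow> real" and c :: "nat \<Rightarrow> real"
  assume "L2_torus f" "(LINT x:{0..1}|lborel. f x) = 0"
    "summable (\<lambda>k. (c (Suc k))\<^sup>2 * hfun f (Suc k) * (ln (real (Suc k)))\<^sup>2)"
  then show "AE x in lborel. x \<in> {0..1} \<longrightarrow> summable (\<lambda>k. c (Suc k) * f (real (Suc k) * x))"
    by (rule AE_summable_dilated_series)
qed (rule dilated_series_counterexample)

end
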